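(* Let $G$ be a $3$-edge-connected graph. Then the following are equivalent: (1) $\operatorname{gon}(G)=3$. (2) There exists a non-degenerate harmonic morphism $\varphi:G\to T$ with $\deg(\varphi)=3$ and $T$ a tree, or $|V(G)|=3$.
   Context: A graph is finite, connected, loopless, and may have multiple edges. $k$-edge-connected means deleting any $k-1$ edges leaves the graph connected. Divisors are integer combinations of vertices; $D\sim D'$ if $D-D'$ is in the image of the Laplacian ($\Delta_{v,v}=\mathrm{val}(v)$, $\Delta_{v,w}=-$number of edges between $v,w$). The rank $r(D)$ is $-1$ if no effective divisor is equivalent to $D$, and otherwise the largest $k$ such that for every effective divisor $F$ of degree $k$ some effective divisor is equivalent to $D-F$. $\operatorname{gon}(G)$ is the minimum degree of an effective divisor of rank $\ge1$. A morphism $\varphi:G\to G'$ maps vertices to vertices and edges to edges or vertices, such that an edge $uv$ with $\varphi(u)=\varphi(v)$ maps to the vertex $\varphi(u)$ and an edge $uv$ with $\varphi(u)\neq\varphi(v)$ maps to an edge joining $\varphi(u),\varphi(v)$. For $v\in V(G)$ and an edge $e'$ incident to $\varphi(v)$, let $m_\varphi(v,e')$ be the number of edges at $v$ mapping to $e'$; $\varphi$ is harmonic if this is independent of $e'$ (call it $m_\varphi(v)$), non-degenerate if $m_\varphi(v)>0$ for all $v$, and $\deg\varphi=|\varphi^{-1}(e')|$ for any edge $e'$ of $G'$. A tree is a connected graph of genus $|E|-|V|+1=0$.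
   Formalization: The graph with two vertices joined by exactly three parallel edges is excluded: it is 3-edge-connected and has a non-degenerate harmonic morphism of degree 3 to a one-edge tree, but its gonality is at most 2, so the equivalence fails for it. *)

theory Defs
  imports Main
begin

record ('v, 'e) mgraph =
  verts :: "'v set"
  edges :: "'e set"
  ends :: "'e \<Rightarrow> 'v set"

definition adj_rel :: "('v, 'e) mgraph \<Rightarrow> 'v rel" where
  "adj_rel G = {(u, v). \<exists>e\<in>edges G. ends G e = {u, v}}"

definition mg_connected :: "('v, 'e) mgraph \<Rightarrow> bool" where
  "mg_connected G \<longleftrightarrow> verts G \<noteq> {} \<and> (\<forall>u\<in>verts G. \<forall>v\<in>verts G. (u, v) \<in> (adj_rel G)\<^sup>*)"

text \<open>Looplessness is the requirement that every edge has exactly two ends; parallel edges are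
  distinct elements of \<open>edges G\<close> with the same set of ends.\<close>

definition mg_graph :: "('v, 'e) mgraph \<Rightarrow> bool" where
  "mg_graph G \<longleftrightarrow>
     finite (verts G) \<and> finite (edges G) \<and>
     (\<forall>e\<in>edges G. ends G e \<subseteq> verts G \<and> card (ends G e) = 2) \<and>
     mg_connected G"

definition delete_edges :: "('v, 'e) mgraph \<Rightarrow> 'e set \<Rightarrow> ('v, 'e) mgraph" where
  "delete_edges G F = G\<lparr>edges := edges G - F\<rparr>"

text \<open>Exactly \<open>k - 1\<close> edges are deleted. A connected graph with at least \<open>k - 1\<close> edges stays
  connected after deleting any fewer edges, too; with fewer than \<open>k - 1\<close> edges the condition is
  vacuous, which for \<open>k = 3\<close> admits, besides the one-vertex graph, only a single edge.\<close>

definition k_edge_connected :: "nat \<Rightarrow> ('v, 'e) mgraph \<Rightarrow> bool" where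
  "k_edge_connected k G \<longleftrightarrow>
     (\<forall>F. F \<subseteq> edges G \<and> card F + 1 = k \<longrightarrow> mg_connected (delete_edges G F))"

definition genus :: "('v, 'e) mgraph \<Rightarrow> int" where
  "genus G = int (card (edges G)) - int (card (verts G)) + 1"

definition is_tree :: "('v, 'e) mgraph \<Rightarrow> bool" where
  "is_tree T \<longleftrightarrow> mg_graph T \<and> genus T = 0"


section \<open>Divisors, rank and gonality\<close>

definition val :: "('v, 'e) mgraph \<Rightarrow> 'v \<Rightarrow> nat" where
  "val G v = card {e \<in> edges G. v \<in> ends G e}"

definition laplacian :: "('v, 'e) mgraph \<Rightarrow> 'v \<Rightarrow> 'v \<Rightarrow> int" where
  "laplacian G v w =
     (if v = w then int (val G v) else - int (card {e \<in> edges G. ends G e = {v, w}}))"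

definition divisor :: "('v, 'e) mgraph \<Rightarrow> ('v \<Rightarrow> int) \<Rightarrow> bool" where
  "divisor G D \<longleftrightarrow> (\<forall>v. v \<notin> verts G \<longrightarrow> D v = 0)"

definition effective :: "('v, 'e) mgraph \<Rightarrow> ('v \<Rightarrow> int) \<Rightarrow> bool" where
  "effective G D \<longleftrightarrow> divisor G D \<and> (\<forall>v\<in>verts G. 0 \<le> D v)"

definition div_degree :: "('v, 'e) mgraph \<Rightarrow> ('v \<Rightarrow> int) \<Rightarrow> int" where
  "div_degree G D = (\<Sum>v\<in>verts G. D v)"

definition div_equiv :: "('v, 'e) mgraph \<Rightarrow> ('v \<Rightarrow> int) \<Rightarrow> ('v \<Rightarrow> int) \<Rightarrow> bool" where
  "div_equiv G D D' \<longleftrightarrow>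
     (\<exists>f. \<forall>v\<in>verts G. D v - D' v = (\<Sum>w\<in>verts G. laplacian G v w * f w))"

definition equiv_to_effective :: "('v, 'e) mgraph \<Rightarrow> ('v \<Rightarrow> int) \<Rightarrow> bool" where
  "equiv_to_effective G D \<longleftrightarrow> (\<exists>E. effective G E \<and> div_equiv G D E)"

text \<open>The \<open>GREATEST\<close> is over a set of naturals that contains \<open>0\<close> and is bounded by the degree
  of \<open>D\<close>, because equivalent divisors have the same degree.\<close>

definition div_rank :: "('v, 'e) mgraph \<Rightarrow> ('v \<Rightarrow> int) \<Rightarrow> int" where
  "div_rank G D =
     (if \<not> equiv_to_effective G D then - 1
      else int (GREATEST k. \<forall>F. effective G F \<and> div_degree G F = int k \<longrightarrow>
                              equiv_to_effective G (\<lambda>v. D v - F v)))"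

definition gonality :: "('v, 'e) mgraph \<Rightarrow> nat" where
  "gonality G = (LEAST d. \<exists>D. effective G D \<and> div_degree G D = int d \<and> 1 \<le> div_rank G D)"


section \<open>Harmonic morphisms\<close>

text \<open>A map sending vertices to vertices and edges to edges or vertices: \<open>Inl\<close> marks an edge
  contracted to a vertex, \<open>Inr\<close> an edge mapped to an edge.\<close>

record ('v, 'e, 'w, 'f) mg_map =
  vmap :: "'v \<Rightarrow> 'w"
  emap :: "'e \<Rightarrow> 'w + 'f"

definition is_morphism ::
  "('v, 'e) mgraph \<Rightarrow> ('w, 'f) mgraph \<Rightarrow> ('v, 'e, 'w, 'f) mg_map \<Rightarrow> bool" where
  "is_morphism G G' \<phi> \<longleftrightarrow>
     (\<forall>v\<in>verts G. vmap \<phi> v \<in> verts G') \<and>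
     (\<forall>e\<in>edges G. \<forall>u v. ends G e = {u, v} \<longrightarrow>
        (if vmap \<phi> u = vmap \<phi> v then emap \<phi> e = Inl (vmap \<phi> u)
         else (\<exists>e'\<in>edges G'. emap \<phi> e = Inr e' \<and> ends G' e' = {vmap \<phi> u, vmap \<phi> v})))"

definition edge_mult ::
  "('v, 'e) mgraph \<Rightarrow> ('v, 'e, 'w, 'f) mg_map \<Rightarrow> 'v \<Rightarrow> 'f \<Rightarrow> nat" where
  "edge_mult G \<phi> v e' = card {e \<in> edges G. v \<in> ends G e \<and> emap \<phi> e = Inr e'}"

definition incident_edges :: "('w, 'f) mgraph \<Rightarrow> 'w \<Rightarrow> 'f set" where
  "incident_edges G' w = {e' \<in> edges G'. w \<in> ends G' e'}"

definition is_harmonic ::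
  "('v, 'e) mgraph \<Rightarrow> ('w, 'f) mgraph \<Rightarrow> ('v, 'e, 'w, 'f) mg_map \<Rightarrow> bool" where
  "is_harmonic G G' \<phi> \<longleftrightarrow> is_morphism G G' \<phi> \<and>
     (\<forall>v\<in>verts G. \<forall>e1\<in>incident_edges G' (vmap \<phi> v). \<forall>e2\<in>incident_edges G' (vmap \<phi> v).
        edge_mult G \<phi> v e1 = edge_mult G \<phi> v e2)"

text \<open>For harmonic morphisms of connected graphs, neither of the following two numbers depends on
  the chosen edge of the target. When there is no edge to choose, that is, when the target is a
  single vertex, both are \<open>0\<close>, following Baker and Norine.\<close>

definition vertex_mult ::
  "('v, 'e) mgraph \<Rightarrow> ('w, 'f) mgraph \<Rightarrow> ('v, 'e, 'w, 'f) mg_map \<Rightarrow> 'v \<Rightarrow> nat" where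
  "vertex_mult G G' \<phi> v =
     (if incident_edges G' (vmap \<phi> v) = {} then 0
      else edge_mult G \<phi> v (SOME e'. e' \<in> incident_edges G' (vmap \<phi> v)))"

definition morphism_degree ::
  "('v, 'e) mgraph \<Rightarrow> ('w, 'f) mgraph \<Rightarrow> ('v, 'e, 'w, 'f) mg_map \<Rightarrow> nat" where
  "morphism_degree G G' \<phi> =
     (if edges G' = {} then 0
      else card {e \<in> edges G. emap \<phi> e = Inr (SOME e'. e' \<in> edges G')})"

definition nondegenerate ::
  "('v, 'e) mgraph \<Rightarrow> ('w, 'f) mgraph \<Rightarrow> ('v, 'e, 'w, 'f) mg_map \<Rightarrow> bool" where
  "nondegenerate G G' \<phi> \<longleftrightarrow> (\<forall>v\<in>verts G. 0 < vertex_mult G G' \<phi> v)"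


section \<open>The two-vertex graph with three parallel edges\<close>

text \<open>This graph is 3-edge-connected and maps harmonically, non-degenerately and with degree 3
  onto the tree with one edge, but its gonality is at most 2. So the existence of such
  a morphism does not imply gonality 3 for this graph.\<close>

definition theta :: "(nat, nat) mgraph" where
  "theta = \<lparr>verts = {0, 1}, edges = {0, 1, 2}, ends = (\<lambda>_. {0, 1})\<rparr>"

lemma theta_sel [simp]:
  "verts theta = {0, 1}" "edges theta = {0, 1, 2}" "ends theta e = {0, 1}"
  by (simp_all add: theta_def)

lemma two_vertex_connected:
  assumes "verts G = {0, 1::nat}" "e \<in> edges G" "ends G e = {0, 1}"
  shows "mg_connected G"
proof -
  have "(0, 1) \<in> adj_rel G" "(1, 0) \<in> adj_rel G"
    using assms by (auto simp: adj_rel_def insert_commute)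
  then show ?thesis
    using assms by (auto simp: mg_connected_def)
qed

lemma theta_graph: "mg_graph theta"
  using two_vertex_connected[of theta 0] by (auto simp: mg_graph_def)

lemma theta_3_edge_connected: "k_edge_connected 3 theta"
  unfolding k_edge_connected_def
proof (intro allI impI)
  fix F assume F: "F \<subseteq> edges theta \<and> card F + 1 = 3"
  have "\<not> edges theta \<subseteq> F"
  proof
    assume "edges theta \<subseteq> F"
    with F have "F = {0, 1, 2}" by auto
    with F show False by simp
  qed
  then obtain e where "e \<in> edges theta - F" by blast
  then show "mg_connected (delete_edges theta F)"
    by (intro two_vertex_connected[of _ e]) (auto simp: delete_edges_def)
qed

lemma theta_harmonic_morphism:
  "\<exists>(T :: (nat, nat) mgraph) \<phi>. is_tree T \<and> is_harmonic theta T \<phi> \<and>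
     nondegenerate theta T \<phi> \<and> morphism_degree theta T \<phi> = 3"
proof -
  define T :: "(nat, nat) mgraph"
    where "T = \<lparr>verts = {0, 1}, edges = {0}, ends = (\<lambda>_. {0, 1})\<rparr>"
  define \<phi> :: "(nat, nat, nat, nat) mg_map"
    where "\<phi> = \<lparr>vmap = (\<lambda>v. v), emap = (\<lambda>_. Inr 0)\<rparr>"
  have T [simp]: "verts T = {0, 1}" "edges T = {0}" "ends T e = {0, 1}" for e
    by (simp_all add: T_def)
  have \<phi> [simp]: "vmap \<phi> v = v" "emap \<phi> e = Inr 0" for v e
    by (simp_all add: \<phi>_def)
  have "is_tree T"
    using two_vertex_connected[of T 0] by (auto simp: is_tree_def mg_graph_def genus_def)
  moreover have "is_harmonic theta T \<phi>"
    by (auto simp: is_harmonic_def is_morphism_def incident_edges_def doubleton_eq_iff)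
  moreover have inc: "incident_edges T v = {0}" if "v \<in> {0, 1}" for v
    using that by (auto simp: incident_edges_def)
  have e3: "{e. e = 0 \<or> e = Suc 0 \<or> e = 2} = {0, Suc 0, 2}" by auto
  have "nondegenerate theta T \<phi>"
    by (auto simp: nondegenerate_def vertex_mult_def inc edge_mult_def e3)
  moreover have "morphism_degree theta T \<phi> = 3"
    by (simp add: morphism_degree_def e3)
  ultimately show ?thesis by blast
qed

lemma theta_equiv_degree:
  assumes "div_equiv theta D D'"
  shows "div_degree theta D = div_degree theta D'"
proof -
  obtain f where f: "\<forall>v\<in>verts theta. D v - D' v = (\<Sum>w\<in>verts theta. laplacian theta v w * f w)"
    using assms by (auto simp: div_equiv_def)
  have e3: "{e. e = 0 \<or> e = Suc 0 \<or> e = 2} = {0, Suc 0, 2}" by auto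
  show ?thesis
    using f by (simp add: div_degree_def laplacian_def val_def e3 insert_commute)
qed

lemma theta_gonality: "gonality theta \<le> 2"
proof -
  define D :: "nat \<Rightarrow> int" where "D = (\<lambda>v. if v \<in> {0, 1} then 1 else 0)"
  let ?P = "\<lambda>k. \<forall>F. effective theta F \<and> div_degree theta F = int k \<longrightarrow>
                   equiv_to_effective theta (\<lambda>v. D v - F v)"
  have eff: "equiv_to_effective theta E" if "effective theta E" for E
    unfolding equiv_to_effective_def div_equiv_def
    by (intro exI[of _ E] conjI that exI[of _ "\<lambda>_. 0"]) simp
  have D: "effective theta D" "div_degree theta D = 2"
    by (auto simp: D_def effective_def divisor_def div_degree_def)
  have P1: "?P 1"
  proof (intro allI impI)
    fix F assume "effective theta F \<and> div_degree theta F = int 1"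
    then have "effective theta (\<lambda>v. D v - F v)"
      by (auto simp: D_def effective_def divisor_def div_degree_def)
    then show "equiv_to_effective theta (\<lambda>v. D v - F v)" by (rule eff)
  qed
  have bound: "k \<le> 2" if Pk: "?P k" for k
  proof -
    let ?F = "\<lambda>v::nat. if v = 0 then int k else 0"
    have F: "effective theta ?F" "div_degree theta ?F = int k"
      by (auto simp: effective_def divisor_def div_degree_def)
    then obtain E where E: "effective theta E" "div_equiv theta (\<lambda>v. D v - ?F v) E"
      using Pk unfolding equiv_to_effective_def by blast
    from theta_equiv_degree[OF E(2)] E(1) show ?thesis
      by (auto simp: effective_def div_degree_def D_def)
  qed
  have "1 \<le> (GREATEST k. ?P k)"
    by (rule Greatest_le_nat[of ?P 1 2, OF P1]) (use bound in blast)
  then have "1 \<le> div_rank theta D"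
    using eff[OF D(1)] by (simp add: div_rank_def)
  then show ?thesis
    unfolding gonality_def by (intro Least_le exI[of _ D]) (use D in simp)
qed

end

(* Fire along a potential f between two effective divisors of degree 3. Every cut has at least 3
   edges, so on the set A where f is maximal the first divisor is exactly the number of edges
   leaving A, it vanishes off A, and f drops by 1 across the cut. Hence two equivalent divisors
   that share a point of their supports are equal, and a divisor of degree 3 and positive rank
   partitions the vertices into the supports of the members of its linear system. Collapsing these
   supports gives the morphism; an edge between two supports lies in the cut of A, which is
   the full preimage of one edge of the quotient, so every edge of the quotient is a bridge.
   Conversely, the fibres of a morphism to a tree, weighted by multiplicity, are equivalent
   divisors: fire the preimage of one side of an edge. Degrees below 3 are excluded by the cuts as
   soon as there are 3 vertices; on 2 vertices every edge lies over the same edge of the tree. *)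

theory Submission
  imports Defs "HOL-Library.Nat_Bijection"
begin

section \<open>Cuts and connectivity\<close>

text \<open>The number 3 enters as a k that is both the degree of the divisor and a lower bound for
  all cuts; this coincidence makes every estimate tight, and the lemmas are stated for such k. The
  alternative |V(G)| = 3 arises because a class of positive rank may contain a single effective
  divisor, whose support is then everything. This is impossible if |V| > k, but on three vertices
  the all-ones divisor can be alone in its class, and collapsing supports then leaves one vertex and
  no edge. The obstacle is that the fired set A must be a union of supports. The potential between
  two divisors says nothing directly about a third support, which could straddle the cut; a third
  member of the class is therefore compared with both.\<close>

definition cut_edges :: "('v, 'e) mgraph \<Rightarrow> 'v set \<Rightarrow> 'e set" where
  "cut_edges G A = {e \<in> edges G. ends G e \<inter> A \<noteq> {} \<and> ends G e - A \<noteq> {}}"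

lemma mg_graphD:
  assumes "mg_graph G"
  shows "finite (verts G)" "finite (edges G)" "verts G \<noteq> {}" "mg_connected G"
    and "\<And>e. e \<in> edges G \<Longrightarrow> ends G e \<subseteq> verts G"
    and "\<And>e. e \<in> edges G \<Longrightarrow> card (ends G e) = 2"
    and "\<And>e. e \<in> edges G \<Longrightarrow> finite (ends G e)"
  using assms unfolding mg_graph_def mg_connected_def
  by (auto intro: card_ge_0_finite)

lemma edge_endsE:
  assumes "mg_graph G" "e \<in> edges G"
  obtains u v where "ends G e = {u, v}" "u \<noteq> v" "u \<in> verts G" "v \<in> verts G"
  using mg_graphD(5,6)[OF assms] by (auto simp: card_2_iff)

lemma edge_ends_atE:
  assumes "mg_graph G" "e \<in> edges G" "u \<in> ends G e"
  obtains v where "ends G e = {u, v}" "u \<noteq> v" "u \<in> verts G" "v \<in> verts G"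
proof -
  obtain x y where xy: "ends G e = {x, y}" "x \<noteq> y" "x \<in> verts G" "y \<in> verts G"
    using edge_endsE[OF assms(1,2)] .
  show ?thesis
  proof (cases "u = x")
    case True
    then show ?thesis using that[of y] xy by simp
  next
    case False
    then show ?thesis using that[of x] xy assms(3) by auto
  qed
qed

lemma edge_ends_eq:
  assumes "mg_graph G" "e \<in> edges G" "u \<in> ends G e" "v \<in> ends G e" "u \<noteq> v"
  shows "ends G e = {u, v}"
proof -
  obtain w where "ends G e = {u, w}" using edge_ends_atE[OF assms(1-3)] .
  then show ?thesis using assms(4,5) by auto
qed

lemma finite_cut_edges: "mg_graph G \<Longrightarrow> finite (cut_edges G A)"
  using mg_graphD(2)[of G] by (simp add: cut_edges_def)

text \<open>A path leaving A uses an edge of its cut; conversely, the set of vertices reachable from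
  u has an empty cut. Only the shape of the edges is assumed, so that the criterion applies where
  connectivity is in question: to \<open>delete_edges G F\<close> and to the quotient.\<close>

lemma mg_connected_iff_cut:
  assumes "\<And>e. e \<in> edges G \<Longrightarrow> ends G e \<subseteq> verts G \<and> card (ends G e) = 2"
  shows "mg_connected G \<longleftrightarrow> verts G \<noteq> {} \<and>
    (\<forall>A. A \<subseteq> verts G \<and> A \<noteq> {} \<and> A \<noteq> verts G \<longrightarrow> cut_edges G A \<noteq> {})"
proof (intro iffI conjI allI impI)
  assume conn: "mg_connected G"
  then show "verts G \<noteq> {}" by (simp add: mg_connected_def)
  fix A assume A: "A \<subseteq> verts G \<and> A \<noteq> {} \<and> A \<noteq> verts G"
  then obtain a b where ab: "a \<in> A" "b \<in> verts G" "b \<notin> A" by blast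
  show "cut_edges G A \<noteq> {}"
  proof
    assume empty: "cut_edges G A = {}"
    have "(a, b) \<in> (adj_rel G)\<^sup>*"
      using conn A ab by (auto simp: mg_connected_def)
    then have "b \<in> A"
    proof (induction rule: rtrancl_induct)
      case (step y z)
      from step(2) obtain e where "e \<in> edges G" "ends G e = {y, z}"
        by (auto simp: adj_rel_def)
      with step(3) empty show ?case by (auto simp: cut_edges_def)
    qed (use ab in simp)
    with ab show False by simp
  qed
next
  assume *: "verts G \<noteq> {} \<and>
    (\<forall>A. A \<subseteq> verts G \<and> A \<noteq> {} \<and> A \<noteq> verts G \<longrightarrow> cut_edges G A \<noteq> {})"
  show "mg_connected G"
    unfolding mg_connected_def
  proof (intro conjI ballI)
    show "verts G \<noteq> {}" using * by simp
    fix u v assume uv: "u \<in> verts G" "v \<in> verts G"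
    define A where "A = {x \<in> verts G. (u, x) \<in> (adj_rel G)\<^sup>*}"
    have "cut_edges G A = {}"
    proof (rule ccontr)
      assume "cut_edges G A \<noteq> {}"
      then obtain e x y where e: "e \<in> edges G" "x \<in> ends G e" "x \<in> A" "y \<in> ends G e" "y \<notin> A"
        by (auto simp: cut_edges_def)
      with assms[of e] have "ends G e = {x, y}" "y \<in> verts G"
        by (auto simp: card_2_iff)
      then have "(x, y) \<in> adj_rel G" using e by (auto simp: adj_rel_def)
      with e \<open>y \<in> verts G\<close> show False
        by (auto simp: A_def intro: rtrancl_into_rtrancl)
    qed
    moreover have "u \<in> A" "A \<subseteq> verts G" using uv by (auto simp: A_def)
    ultimately have "A = verts G" using * by blast
    with uv show "(u, v) \<in> (adj_rel G)\<^sup>*" by (auto simp: A_def)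
  qed
qed

lemma connected_cut:
  assumes "mg_graph G" "A \<subseteq> verts G" "A \<noteq> {}" "A \<noteq> verts G"
  shows "cut_edges G A \<noteq> {}"
  using mg_connected_iff_cut[of G] mg_graphD(4,5,6)[OF assms(1)] assms(2-) by metis

section \<open>Spanning trees, bridges and the lower bound for cuts\<close>

text \<open>The tree is grown one vertex at a time, along an edge in the cut of the set reached so
  far. Meeting every cut is the form in which its connectivity is used later.\<close>

lemma spanning_tree:
  assumes G: "mg_graph G"
  shows "\<exists>F \<subseteq> edges G. card F + 1 = card (verts G) \<and>
    (\<forall>A. A \<subseteq> verts G \<and> A \<noteq> {} \<and> A \<noteq> verts G \<longrightarrow> cut_edges G A \<inter> F \<noteq> {})"
proof -
  have grow: "\<exists>S F. S \<subseteq> verts G \<and> card S = Suc n \<and> F \<subseteq> edges G \<and> card F = n \<and>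
      (\<forall>e\<in>F. ends G e \<subseteq> S) \<and>
      (\<forall>A. A \<subseteq> S \<and> A \<noteq> {} \<and> A \<noteq> S \<longrightarrow> cut_edges G A \<inter> F \<noteq> {})"
    if "Suc n \<le> card (verts G)" for n
    using that
  proof (induction n)
    case 0
    obtain r where "r \<in> verts G" using mg_graphD(3)[OF G] by blast
    then show ?case by (intro exI[of _ "{r}"] exI[of _ "{}"]) auto
  next
    case (Suc n)
    then obtain S F where SF: "S \<subseteq> verts G" "card S = Suc n" "F \<subseteq> edges G" "card F = n"
      "\<And>e. e \<in> F \<Longrightarrow> ends G e \<subseteq> S"
      and cut: "\<And>A. A \<subseteq> S \<Longrightarrow> A \<noteq> {} \<Longrightarrow> A \<noteq> S \<Longrightarrow> cut_edges G A \<inter> F \<noteq> {}"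
      by (metis Suc_leD)
    have "S \<noteq> {}" "S \<noteq> verts G" using SF(2) Suc.prems by auto
    then obtain e x where e: "e \<in> edges G" "x \<in> ends G e" "x \<in> S" and n: "ends G e - S \<noteq> {}"
      using connected_cut[OF G SF(1)] by (auto simp: cut_edges_def)
    obtain y where y: "ends G e = {x, y}" "x \<noteq> y" "y \<in> verts G"
      using edge_ends_atE[OF G e(1,2)] by metis
    with n e have "y \<notin> S" by auto
    have fin: "finite S" "finite F"
      using SF(1,3) mg_graphD(1,2)[OF G] finite_subset by blast+
    have "e \<notin> F" using SF(5)[of e] y \<open>y \<notin> S\<close> by auto
    \<comment> \<open>If A splits S, an edge of F inside S already crosses; otherwise A is {y} or S,
      and the new edge e crosses.\<close>
    have "cut_edges G A \<inter> insert e F \<noteq> {}"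
      if A: "A \<subseteq> insert y S" "A \<noteq> {}" "A \<noteq> insert y S" for A
    proof (cases "A \<inter> S = {} \<or> A \<inter> S = S")
      case True
      then have "A = {y} \<or> A = S" using A by blast
      then have "e \<in> cut_edges G A"
        using e y \<open>y \<notin> S\<close> by (auto simp: cut_edges_def)
      then show ?thesis by blast
    next
      case False
      then obtain e' where "e' \<in> cut_edges G (A \<inter> S)" "e' \<in> F"
        using cut[of "A \<inter> S"] by blast
      then have "e' \<in> cut_edges G A" using SF(5)[of e'] by (auto simp: cut_edges_def)
      with \<open>e' \<in> F\<close> show ?thesis by blast
    qed
    moreover have "\<forall>e\<in>insert e F. ends G e \<subseteq> insert y S"
      using SF(5) y(1) e(3) by auto
    ultimately show ?case
      using SF e y \<open>y \<notin> S\<close> \<open>e \<notin> F\<close> fin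
      by (intro exI[of _ "insert y S"] exI[of _ "insert e F"]) simp
  qed
  have pos: "card (verts G) > 0" using mg_graphD(1,3)[OF G] by (simp add: card_gt_0_iff)
  from grow[of "card (verts G) - 1"] pos
  obtain S F where SF: "S \<subseteq> verts G" "card S = card (verts G)" "F \<subseteq> edges G"
      "card F = card (verts G) - 1"
      and cut: "\<And>A. A \<subseteq> S \<Longrightarrow> A \<noteq> {} \<Longrightarrow> A \<noteq> S \<Longrightarrow> cut_edges G A \<inter> F \<noteq> {}"
    by (auto simp: Suc_diff_1)
  have "S = verts G" using SF mg_graphD(1)[OF G] by (metis card_subset_eq)
  with SF cut pos show ?thesis by (intro exI[of _ F]) auto
qed

text \<open>An edge that is alone in a cut belongs to every set of edges meeting all cuts, so the
  |V| - 1 edges of \<open>spanning_tree\<close> are all there are.\<close>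

lemma is_tree_if_bridges:
  assumes T: "mg_graph T"
    and bridge: "\<And>e. e \<in> edges T \<Longrightarrow> \<exists>X \<subseteq> verts T. cut_edges T X = {e}"
  shows "is_tree T"
proof -
  obtain F where F: "F \<subseteq> edges T" "card F + 1 = card (verts T)"
    and cut: "\<And>A. A \<subseteq> verts T \<Longrightarrow> A \<noteq> {} \<Longrightarrow> A \<noteq> verts T \<Longrightarrow> cut_edges T A \<inter> F \<noteq> {}"
    using spanning_tree[OF T] by metis
  have "edges T \<subseteq> F"
  proof
    fix e assume e: "e \<in> edges T"
    then obtain X where X: "X \<subseteq> verts T" "cut_edges T X = {e}" using bridge by blast
    have "e \<in> cut_edges T X" using X by simp
    then have "X \<noteq> {}" "X \<noteq> verts T"
      using mg_graphD(5)[OF T e] by (auto simp: cut_edges_def)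
    with cut[OF X(1)] X show "e \<in> F" by auto
  qed
  with F have "edges T = F" by blast
  with F T show ?thesis by (simp add: is_tree_def genus_def)
qed

text \<open>If T stayed connected without e, \<open>spanning_tree\<close> would find |V| - 1 edges
  among the remaining |V| - 2. So some cut becomes empty, and in T it can contain only e.\<close>

lemma tree_bridge:
  assumes "is_tree T" "e \<in> edges T"
  obtains X where "X \<subseteq> verts T" "cut_edges T X = {e}"
proof -
  have T: "mg_graph T" using assms(1) by (simp add: is_tree_def)
  let ?H = "delete_edges T {e}"
  have H: "edges ?H = edges T - {e}" "verts ?H = verts T" "ends ?H = ends T"
    by (auto simp: delete_edges_def)
  have "\<not> mg_connected ?H"
  proof
    assume "mg_connected ?H"
    then have "mg_graph ?H" using T by (auto simp: mg_graph_def H)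
    from spanning_tree[OF this] obtain F where
      F: "F \<subseteq> edges T - {e}" "card F + 1 = card (verts T)" by (auto simp: H)
    have "card F \<le> card (edges T - {e})"
      using F mg_graphD(2)[OF T] by (intro card_mono) auto
    then have "card F < card (edges T)"
      using card_Diff1_less[OF mg_graphD(2)[OF T] assms(2)] by linarith
    with F(2) assms(1) show False by (simp add: is_tree_def genus_def)
  qed
  then obtain X where X: "X \<subseteq> verts T" "X \<noteq> {}" "X \<noteq> verts T" "cut_edges ?H X = {}"
    using mg_connected_iff_cut[of ?H] mg_graphD(3,5,6)[OF T] by (auto simp: H)
  then have "cut_edges T X \<subseteq> {e}" by (auto simp: cut_edges_def H)
  with connected_cut[OF T X(1-3)] have "cut_edges T X = {e}" by blast
  with X(1) show ?thesis by (rule that)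
qed

text \<open>\<open>k_edge_connected\<close> speaks of exactly k - 1 deleted edges, so a smaller cut
  is padded to that size. For k \<le> |V| a spanning tree guarantees enough edges; a single edge
  with k = 3 shows what the bound prevents.\<close>

lemma cut_card_ge:
  assumes G: "mg_graph G" and conn: "k_edge_connected k G" and k: "k \<le> card (verts G)"
    and A: "A \<subseteq> verts G" "A \<noteq> {}" "A \<noteq> verts G"
  shows "k \<le> card (cut_edges G A)"
proof (rule ccontr)
  assume less: "\<not> k \<le> card (cut_edges G A)"
  obtain S where S: "S \<subseteq> edges G" "card S + 1 = card (verts G)"
    using spanning_tree[OF G] by blast
  then have "k - 1 \<le> card (edges G)"
    using k card_mono[OF mg_graphD(2)[OF G] S(1)] by linarith
  moreover have "cut_edges G A \<subseteq> edges G" by (auto simp: cut_edges_def)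
  moreover have "card (cut_edges G A) \<le> k - 1" using less by linarith
  ultimately obtain F where F: "cut_edges G A \<subseteq> F" "F \<subseteq> edges G" "card F = k - 1"
    using exists_subset_between[of "cut_edges G A" "k - 1" "edges G"] mg_graphD(2)[OF G]
    by metis
  let ?H = "delete_edges G F"
  have H: "edges ?H = edges G - F" "verts ?H = verts G" "ends ?H = ends G"
    by (auto simp: delete_edges_def)
  have "mg_connected ?H"
    using conn F less unfolding k_edge_connected_def by auto
  then have "cut_edges ?H A \<noteq> {}"
    using mg_connected_iff_cut[of ?H] mg_graphD(5,6)[OF G] A by (auto simp: H)
  with F show False by (auto simp: cut_edges_def H)
qed

section \<open>The Laplacian\<close>

text \<open>The term \<open>w = v\<close> of the inner sum vanishes, so the inner sum is the difference of \<open>f\<close> along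
  the edge \<open>e\<close>.\<close>

definition lap :: "('v, 'e) mgraph \<Rightarrow> ('v \<Rightarrow> int) \<Rightarrow> 'v \<Rightarrow> int" where
  "lap G f v = (\<Sum>e\<in>incident_edges G v. \<Sum>w\<in>ends G e. f v - f w)"

lemma finite_incident: "mg_graph G \<Longrightarrow> finite (incident_edges G v)"
  using mg_graphD(2)[of G] by (simp add: incident_edges_def)

lemma laplacian_sum:
  assumes G: "mg_graph G" and v: "v \<in> verts G"
  shows "(\<Sum>w\<in>verts G. laplacian G v w * f w) = lap G f v"
proof -
  let ?I = "incident_edges G v"
  have fin: "finite (verts G)" "finite ?I" using mg_graphD(1)[OF G] finite_incident[OF G] by auto
  have "lap G f v = (\<Sum>e\<in>?I. 2 * f v - (\<Sum>w\<in>ends G e. f w))"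
    unfolding lap_def
    by (intro sum.cong refl) (simp add: sum_subtractf mg_graphD(6)[OF G] incident_edges_def)
  also have "\<dots> = 2 * int (val G v) * f v - (\<Sum>e\<in>?I. \<Sum>w\<in>ends G e. f w)"
    by (simp add: sum_subtractf val_def incident_edges_def)
  also have "(\<Sum>e\<in>?I. \<Sum>w\<in>ends G e. f w) =
      (\<Sum>e\<in>?I. \<Sum>w\<in>verts G. if w \<in> ends G e then f w else 0)"
  proof (rule sum.cong[OF refl])
    fix e assume "e \<in> ?I"
    then have "verts G \<inter> ends G e = ends G e"
      using mg_graphD(5)[OF G] by (auto simp: incident_edges_def)
    then show "(\<Sum>w\<in>ends G e. f w) = (\<Sum>w\<in>verts G. if w \<in> ends G e then f w else 0)"
      using sum.inter_restrict[OF fin(1), of f "ends G e"] by simp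
  qed
  also have "\<dots> = (\<Sum>w\<in>verts G. \<Sum>e\<in>?I. if w \<in> ends G e then f w else 0)"
    by (rule sum.swap)
  also have "\<dots> = (\<Sum>w\<in>verts G. int (card {e\<in>?I. w \<in> ends G e}) * f w)"
    by (intro sum.cong refl) (simp add: sum.inter_filter[OF fin(2), symmetric])
  finally have *: "lap G f v = 2 * int (val G v) * f v
      - (\<Sum>w\<in>verts G. int (card {e\<in>?I. w \<in> ends G e}) * f w)" .
  \<comment> \<open>The inner sum of \<open>lap\<close> counts f v once for each end of an edge, so
    the diagonal entry appears as 2 val - val.\<close>
  have L: "laplacian G v w =
      (if w = v then 2 * int (val G v) else 0) - int (card {e\<in>?I. w \<in> ends G e})" for w
  proof (cases "w = v")
    case True
    then have "{e\<in>?I. w \<in> ends G e} = {e \<in> edges G. v \<in> ends G e}"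
      by (auto simp: incident_edges_def)
    then show ?thesis using True by (simp add: laplacian_def val_def)
  next
    case False
    then have "{e\<in>?I. w \<in> ends G e} = {e \<in> edges G. ends G e = {v, w}}"
      using edge_ends_eq[OF G] by (auto simp: incident_edges_def)
    then show ?thesis using False by (simp add: laplacian_def)
  qed
  have "(\<Sum>w\<in>verts G. laplacian G v w * f w) =
      (\<Sum>w\<in>verts G. (if w = v then 2 * int (val G v) * f w else 0)
        - int (card {e\<in>?I. w \<in> ends G e}) * f w)"
    by (intro sum.cong refl) (simp add: L left_diff_distrib)
  also have "\<dots> = lap G f v"
    unfolding sum_subtractf * sum.delta[OF fin(1)] using v by simp
  finally show ?thesis .
qed

lemma div_equiv_iff_lap:
  assumes "mg_graph G"
  shows "div_equiv G D E \<longleftrightarrow> (\<exists>f. \<forall>v\<in>verts G. D v - E v = lap G f v)"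
  unfolding div_equiv_def using laplacian_sum[OF assms] by simp

lemma lap_diff: "lap G (\<lambda>x. f x - g x) v = lap G f v - lap G g v"
  unfolding lap_def by (simp add: algebra_simps flip: sum_subtractf)

lemma lap_uminus: "lap G (\<lambda>x. - f x) v = - lap G f v"
  unfolding lap_def by (simp add: algebra_simps flip: sum_negf)

lemma div_equiv_refl: "div_equiv G D D"
  unfolding div_equiv_def by (intro exI[of _ "\<lambda>_. 0"]) simp

lemma div_equiv_sym:
  assumes "mg_graph G" "div_equiv G D E"
  shows "div_equiv G E D"
proof -
  obtain f where f: "\<forall>v\<in>verts G. D v - E v = lap G f v"
    using assms div_equiv_iff_lap by blast
  then have "\<forall>v\<in>verts G. E v - D v = lap G (\<lambda>x. - f x) v"
    by (simp add: lap_uminus flip: f)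
  then show ?thesis using assms(1) div_equiv_iff_lap by blast
qed

lemma div_equiv_trans:
  assumes G: "mg_graph G" and "div_equiv G C D" "div_equiv G D E"
  shows "div_equiv G C E"
proof -
  obtain f where f: "\<And>v. v \<in> verts G \<Longrightarrow> C v - D v = lap G f v"
    using assms(2) div_equiv_iff_lap[OF G] by blast
  obtain g where g: "\<And>v. v \<in> verts G \<Longrightarrow> E v - D v = lap G g v"
    using div_equiv_sym[OF G assms(3)] div_equiv_iff_lap[OF G] by blast
  have "C v - E v = lap G (\<lambda>x. f x - g x) v" if "v \<in> verts G" for v
    unfolding lap_diff f[OF that, symmetric] g[OF that, symmetric] by simp
  then show ?thesis using div_equiv_iff_lap[OF G] by blast
qed

text \<open>Double counting of incidences; it yields the invariance of the degree, the size of a cut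
  and the degree of a pullback.\<close>

lemma sum_incident_edges_swap:
  assumes G: "mg_graph G" and A: "A \<subseteq> verts G"
  shows "(\<Sum>v\<in>A. \<Sum>e\<in>incident_edges G v. h v e) = (\<Sum>e\<in>edges G. \<Sum>v\<in>ends G e \<inter> A. h v e)"
proof -
  have fin: "finite A" "finite (edges G)" using finite_subset[OF A] mg_graphD(1,2)[OF G] by auto
  have "(\<Sum>v\<in>A. \<Sum>e\<in>incident_edges G v. h v e) =
      (\<Sum>v\<in>A. \<Sum>e\<in>edges G. if v \<in> ends G e then h v e else 0)"
    unfolding incident_edges_def sum.inter_filter[OF fin(2)] ..
  also have "\<dots> = (\<Sum>e\<in>edges G. \<Sum>v\<in>A. if v \<in> ends G e then h v e else 0)"
    by (rule sum.swap)
  also have "\<dots> = (\<Sum>e\<in>edges G. \<Sum>v\<in>ends G e \<inter> A. h v e)"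
    unfolding Int_commute[of _ A] sum.inter_restrict[OF fin(1)] ..
  finally show ?thesis .
qed

lemma div_equiv_degree:
  assumes G: "mg_graph G" and "div_equiv G D E"
  shows "div_degree G D = div_degree G E"
proof -
  obtain f where f: "\<And>v. v \<in> verts G \<Longrightarrow> D v - E v = lap G f v"
    using assms(2) div_equiv_iff_lap[OF G] by blast
  have "div_degree G D - div_degree G E = (\<Sum>v\<in>verts G. lap G f v)"
    unfolding div_degree_def sum_subtractf[symmetric] by (simp add: f)
  also have "\<dots> = (\<Sum>e\<in>edges G. \<Sum>v\<in>ends G e \<inter> verts G. \<Sum>w\<in>ends G e. f v - f w)"
    unfolding lap_def by (rule sum_incident_edges_swap[OF G]) simp
  \<comment> \<open>The differences over ordered pairs of ends are antisymmetric, so they cancel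
    edge by edge.\<close>
  also have "\<dots> = 0"
  proof (rule sum.neutral, rule ballI)
    fix e assume "e \<in> edges G"
    then have "ends G e \<inter> verts G = ends G e" using mg_graphD(5)[OF G] by blast
    then show "(\<Sum>v\<in>ends G e \<inter> verts G. \<Sum>w\<in>ends G e. f v - f w) = 0"
      by (simp add: sum_subtractf sum_distrib_left)
  qed
  finally show ?thesis by simp
qed

text \<open>A cut edge has exactly one end in A and is therefore counted once.\<close>

lemma sum_out_edges:
  assumes G: "mg_graph G" and A: "A \<subseteq> verts G"
  shows "(\<Sum>v\<in>A. card (incident_edges G v \<inter> cut_edges G A)) = card (cut_edges G A)"
proof -
  have "(\<Sum>v\<in>A. card (incident_edges G v \<inter> cut_edges G A)) =
      (\<Sum>v\<in>A. \<Sum>e\<in>incident_edges G v. if e \<in> cut_edges G A then 1 else 0)"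
    unfolding sum.inter_restrict[OF finite_incident[OF G], symmetric] by simp
  also have "\<dots> = (\<Sum>e\<in>edges G. \<Sum>v\<in>ends G e \<inter> A. if e \<in> cut_edges G A then 1 else 0)"
    by (rule sum_incident_edges_swap[OF G A])
  also have "\<dots> = (\<Sum>e\<in>edges G. if e \<in> cut_edges G A then 1 else 0)"
  proof (rule sum.cong[OF refl])
    fix e assume e: "e \<in> edges G"
    have "card (ends G e \<inter> A) = 1" if c: "e \<in> cut_edges G A"
    proof -
      obtain x where x: "x \<in> ends G e" "x \<in> A" using c by (auto simp: cut_edges_def)
      obtain y where y: "ends G e = {x, y}" using edge_ends_atE[OF G e x(1)] by metis
      then have "ends G e \<inter> A = {x}" using c x by (auto simp: cut_edges_def)
      then show ?thesis by simp
    qed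
    then show "(\<Sum>v\<in>ends G e \<inter> A. if e \<in> cut_edges G A then 1 else 0) =
      (if e \<in> cut_edges G A then 1 else 0 :: nat)" by simp
  qed
  also have "\<dots> = card (edges G \<inter> cut_edges G A)"
    unfolding sum.inter_restrict[OF mg_graphD(2)[OF G], symmetric] by simp
  also have "edges G \<inter> cut_edges G A = cut_edges G A" by (auto simp: cut_edges_def)
  finally show ?thesis .
qed

section \<open>Firing the maximum set of a potential\<close>

text \<open>If two effective divisors of degree at most the edge connectivity differ by the Laplacian of
  \<open>f\<close>, every vertex of the set \<open>A\<close> where \<open>f\<close> is maximal sends a chip along each edge leaving \<open>A\<close>.
  The cut has at least \<open>k\<close> edges, so all estimates in this count are equalities.\<close>

lemma argmax_firing:
  assumes G: "mg_graph G"
    and cut: "\<And>A. A \<subseteq> verts G \<Longrightarrow> A \<noteq> {} \<Longrightarrow> A \<noteq> verts G \<Longrightarrow> k \<le> card (cut_edges G A)"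
    and eff: "effective G D" "effective G E" and deg: "div_degree G D \<le> int k"
    and lap: "\<And>v. v \<in> verts G \<Longrightarrow> D v - E v = lap G f v"
    and M: "\<And>v. v \<in> verts G \<Longrightarrow> f v \<le> M"
    and a: "a \<in> verts G" "f a = M" and b: "b \<in> verts G" "f b < M"
  defines "A \<equiv> {v \<in> verts G. f v = M}"
  shows "\<And>v. v \<in> verts G - A \<Longrightarrow> D v = 0"
    and "\<And>v. v \<in> A \<Longrightarrow> E v = 0"
    and "\<And>v. v \<in> A \<Longrightarrow> D v = int (card (incident_edges G v \<inter> cut_edges G A))"
    and "\<And>e w. e \<in> cut_edges G A \<Longrightarrow> w \<in> ends G e - A \<Longrightarrow> f w = M - 1"
    and "card (cut_edges G A) = k"
    and "div_degree G D = int k"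
proof -
  let ?V = "verts G"
  \<comment> \<open>A lower bound for the drop of f from A to w: outside A the integer f w is at
    most M - 1.\<close>
  let ?c = "\<lambda>w. if w \<in> A then 0 else 1 :: int"
  define out where "out v = int (card (incident_edges G v \<inter> cut_edges G A))" for v
  have "b \<notin> A" using b(2) by (simp add: A_def)
  then have A: "A \<subseteq> ?V" "A \<noteq> {}" "A \<noteq> ?V" using a b(1) by (auto simp: A_def)
  have fin: "finite ?V" "finite A" "finite (?V - A)"
    using A(1) mg_graphD(1)[OF G] finite_subset by auto
  have out_eq: "out v = (\<Sum>e\<in>incident_edges G v. \<Sum>w\<in>ends G e. ?c w)" if v: "v \<in> A" for v
  proof -
    have "out v = (\<Sum>e\<in>incident_edges G v. if e \<in> cut_edges G A then 1 else 0)"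
      unfolding out_def sum.inter_restrict[OF finite_incident[OF G], symmetric] by simp
    also have "\<dots> = (\<Sum>e\<in>incident_edges G v. \<Sum>w\<in>ends G e. ?c w)"
    proof (rule sum.cong[OF refl])
      fix e assume "e \<in> incident_edges G v"
      then have e: "e \<in> edges G" "v \<in> ends G e" by (auto simp: incident_edges_def)
      obtain w where "ends G e = {v, w}" "v \<noteq> w" using edge_ends_atE[OF G e] .
      then show "(if e \<in> cut_edges G A then 1 else 0) = (\<Sum>w\<in>ends G e. ?c w)"
        using v e by (auto simp: cut_edges_def)
    qed
    finally show ?thesis .
  qed
  have slack: "lap G f v - out v = (\<Sum>e\<in>incident_edges G v. \<Sum>w\<in>ends G e. f v - f w - ?c w)"
    if "v \<in> A" for v
    unfolding lap_def out_eq[OF that] by (simp flip: sum_subtractf)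
  have nonneg: "0 \<le> f v - f w - ?c w" if "v \<in> A" "e \<in> edges G" "w \<in> ends G e" for v e w
  proof -
    have "w \<in> ?V" using that mg_graphD(5)[OF G] by blast
    then show ?thesis using M[of w] that(1) by (auto simp: A_def)
  qed
  have slack_ge: "0 \<le> lap G f v - out v" if "v \<in> A" for v
    unfolding slack[OF that]
    by (intro sum_nonneg nonneg[OF that]) (auto simp: incident_edges_def)
  have D0: "0 \<le> D v" "0 \<le> E v" if "v \<in> ?V" for v
    using eff that by (auto simp: effective_def)
  \<comment> \<open>The degree of D splits into D off A, E on A, the excess of \<open>lap\<close>
    over \<open>out\<close>, and the size of the cut. The first three are nonnegative and the last
    is at least k, while the total is at most k.\<close>
  have "(\<Sum>v\<in>A. out v) = int (card (cut_edges G A))"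
    unfolding out_def sum_out_edges[OF G A(1), symmetric] by simp
  moreover have "div_degree G D = (\<Sum>v\<in>?V - A. D v) + (\<Sum>v\<in>A. D v)"
    unfolding div_degree_def by (rule sum.subset_diff[OF A(1) fin(1)])
  moreover have "(\<Sum>v\<in>A. D v) = (\<Sum>v\<in>A. E v) + (\<Sum>v\<in>A. lap G f v - out v) + (\<Sum>v\<in>A. out v)"
    unfolding sum.distrib[symmetric] using A(1) lap by (intro sum.cong) force+
  moreover have "int k \<le> int (card (cut_edges G A))" using cut[OF A] by simp
  moreover have nn: "0 \<le> (\<Sum>v\<in>?V - A. D v)" "0 \<le> (\<Sum>v\<in>A. E v)" "0 \<le> (\<Sum>v\<in>A. lap G f v - out v)"
    using D0 A(1) slack_ge by (auto intro!: sum_nonneg)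
  ultimately have z: "(\<Sum>v\<in>?V - A. D v) = 0" "(\<Sum>v\<in>A. E v) = 0"
      "(\<Sum>v\<in>A. lap G f v - out v) = 0"
    and k: "int (card (cut_edges G A)) = int k" "div_degree G D = int k"
    using deg by linarith+
  show "\<And>v. v \<in> ?V - A \<Longrightarrow> D v = 0"
    using z(1) sum_nonneg_eq_0_iff[of "?V - A" D] fin D0 by auto
  show E0: "\<And>v. v \<in> A \<Longrightarrow> E v = 0"
    using z(2) sum_nonneg_eq_0_iff[of A E] fin D0 A(1) by auto
  have s0: "lap G f v = out v" if "v \<in> A" for v
    using z(3) sum_nonneg_eq_0_iff[of A "\<lambda>v. lap G f v - out v"] fin slack_ge that by auto
  show "D v = int (card (incident_edges G v \<inter> cut_edges G A))" if "v \<in> A" for v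
    using E0[OF that] s0[OF that] lap[of v] that A(1) by (auto simp: out_def)
  show "f w = M - 1" if e: "e \<in> cut_edges G A" and w: "w \<in> ends G e - A" for e w
  proof -
    obtain v where v: "v \<in> ends G e" "v \<in> A" using e by (auto simp: cut_edges_def)
    have eE: "e \<in> edges G" using e by (simp add: cut_edges_def)
    then have eI: "e \<in> incident_edges G v" using v by (simp add: incident_edges_def)
    \<comment> \<open>A zero sum of nonnegative terms is taken apart twice, by edges and by ends;
      the drop along e then equals its lower bound.\<close>
    have "(\<Sum>e\<in>incident_edges G v. \<Sum>w\<in>ends G e. f v - f w - ?c w) = 0"
      using s0[OF v(2)] slack[OF v(2)] by simp
    then have "(\<Sum>w\<in>ends G e. f v - f w - ?c w) = 0"
      using sum_nonneg_eq_0_iff[OF finite_incident[OF G],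
          of v "\<lambda>e. \<Sum>w\<in>ends G e. f v - f w - ?c w"] eI
      by (auto simp: incident_edges_def intro: sum_nonneg nonneg[OF v(2)])
    then have "f v - f w - ?c w = 0"
      using sum_nonneg_eq_0_iff[OF mg_graphD(7)[OF G eE], of "\<lambda>w. f v - f w - ?c w"]
        nonneg[OF v(2) eE] w by blast
    then show ?thesis using v w by (simp add: A_def split: if_splits)
  qed
  show "card (cut_edges G A) = k" "div_degree G D = int k" using k by simp_all
qed

section \<open>Rigidity of effective divisors when all cuts are large\<close>

text \<open>The only consequence of edge connectivity that the divisor arguments use;
  \<open>cut_card_ge\<close> supplies it for k \<le> |V|.\<close>

locale cut_bounded =
  fixes G :: "('v, 'e) mgraph" and k :: nat
  assumes G: "mg_graph G"
    and cut_ge: "\<And>A. A \<subseteq> verts G \<Longrightarrow> A \<noteq> {} \<Longrightarrow> A \<noteq> verts G \<Longrightarrow> k \<le> card (cut_edges G A)"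
begin

lemma effective_eqI:
  assumes "effective G D" "effective G E" "\<And>v. v \<in> verts G \<Longrightarrow> D v = E v"
  shows "D = E"
proof
  fix v show "D v = E v"
    using assms by (cases "v \<in> verts G") (auto simp: effective_def divisor_def)
qed

lemma lap_constant:
  assumes "\<And>x y. x \<in> verts G \<Longrightarrow> y \<in> verts G \<Longrightarrow> f x = f y" and v: "v \<in> verts G"
  shows "lap G f v = 0"
  unfolding lap_def
proof (intro sum.neutral ballI)
  fix e w assume "e \<in> incident_edges G v" "w \<in> ends G e"
  then have "w \<in> verts G" using mg_graphD(5)[OF G] by (auto simp: incident_edges_def)
  then show "f v - f w = 0" using assms(1)[OF v, of w] by simp
qed

lemma ex_maximum: "\<exists>a\<in>verts G. \<forall>v\<in>verts G. f v \<le> (f a :: int)"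
proof -
  have "Max (f ` verts G) \<in> f ` verts G"
    using mg_graphD(1,3)[OF G] by (intro Max_in) auto
  then obtain a where a: "a \<in> verts G" "f a = Max (f ` verts G)" by auto
  have "f v \<le> f a" if "v \<in> verts G" for v
    unfolding a(2) using mg_graphD(1)[OF G] that by (intro Max_ge) auto
  with a(1) show ?thesis by blast
qed

text \<open>By \<open>argmax_firing\<close>, D vanishes off the maximum set of a nonconstant f.
  Applied to -f with D and E exchanged, this puts the chips of E where f is minimal.\<close>

lemma support_maximal:
  assumes "effective G D" "effective G E" "div_degree G D \<le> int k"
    and lap: "\<And>v. v \<in> verts G \<Longrightarrow> D v - E v = lap G f v"
    and x: "x \<in> verts G" "0 < D x" and v: "v \<in> verts G"
  shows "f v \<le> f x"
proof -
  obtain a where a: "a \<in> verts G" "\<And>v. v \<in> verts G \<Longrightarrow> f v \<le> f a" using ex_maximum by blast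
  have "f x = f a"
  proof (rule ccontr)
    assume "f x \<noteq> f a"
    with a x have "f x < f a" by fastforce
    from argmax_firing(1)[OF G cut_ge assms(1-3) lap a(2) a(1) refl x(1) this, of x]
    show False using x \<open>f x \<noteq> f a\<close> by simp
  qed
  then show ?thesis using a(2)[OF v] by simp
qed

text \<open>A nonconstant potential would fire a whole cut and force degree k.\<close>

lemma equiv_lt_imp_eq:
  assumes "effective G D" "effective G E" "div_degree G D < int k" "div_equiv G D E"
  shows "D = E"
proof (rule effective_eqI[OF assms(1,2)])
  obtain f where lap: "\<And>v. v \<in> verts G \<Longrightarrow> D v - E v = lap G f v"
    using assms(4) div_equiv_iff_lap[OF G] by blast
  obtain a where a: "a \<in> verts G" "\<And>v. v \<in> verts G \<Longrightarrow> f v \<le> f a" using ex_maximum by blast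
  have "f x = f a" if "x \<in> verts G" for x
  proof (rule ccontr)
    assume "f x \<noteq> f a"
    with a that have "f x < f a" by fastforce
    with argmax_firing(6)[OF G cut_ge assms(1,2) _ lap a(2) a(1) refl that this] assms(3)
    show False by simp
  qed
  then have "lap G f v = 0" if "v \<in> verts G" for v
    using lap_constant[OF _ that] by simp
  then show "D v = E v" if "v \<in> verts G" for v using lap[OF that] that by simp
qed

text \<open>Removing the common chip at v keeps both divisors effective and their difference
  unchanged, but brings the degree below k.\<close>

lemma equiv_common_support:
  assumes "effective G D" "effective G E" "div_degree G D \<le> int k" "div_equiv G D E"
    and v: "v \<in> verts G" "0 < D v" "0 < E v"
  shows "D = E"
proof -
  define P where "P F w = (if w = v then F w - 1 else F w :: int)" for F w
  have "div_degree G (P D) = div_degree G D - 1"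
    using mg_graphD(1)[OF G] v(1) by (simp add: div_degree_def P_def sum.remove)
  moreover have "effective G (P D)" "effective G (P E)"
    using assms by (auto simp: P_def effective_def divisor_def)
  moreover have "P D w - P E w = D w - E w" for w by (simp add: P_def)
  then have "div_equiv G (P D) (P E)"
    using assms(4) by (simp add: div_equiv_def)
  ultimately have "P D = P E" using equiv_lt_imp_eq assms(3) by simp
  then have "P D w = P E w" for w by simp
  then show ?thesis by (intro ext) (metis P_def diff_add_cancel)
qed

end

section \<open>Divisors of positive rank\<close>

lemma effective_single:
  assumes "mg_graph G" "v \<in> verts G"
  shows "effective G (\<lambda>w. if w = v then int n else 0)"
    and "div_degree G (\<lambda>w. if w = v then int n else 0) = int n"
  using assms mg_graphD(1)[OF assms(1)]
  by (auto simp: effective_def divisor_def div_degree_def)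

lemma effective_degree_nonneg: "effective G D \<Longrightarrow> 0 \<le> div_degree G D"
  unfolding effective_def div_degree_def by (auto intro: sum_nonneg)

definition rank_pos :: "('v, 'e) mgraph \<Rightarrow> ('v \<Rightarrow> int) \<Rightarrow> bool" where
  "rank_pos G D \<longleftrightarrow>
    (\<forall>v\<in>verts G. \<exists>E. effective G E \<and> div_equiv G D E \<and> 0 < E v)"

text \<open>Replaces \<open>GREATEST\<close> by a condition on single vertices, since an effective
  divisor of degree 1 is one chip.\<close>

lemma div_rank_ge_1_iff:
  assumes G: "mg_graph G" and D: "effective G D"
  shows "1 \<le> div_rank G D \<longleftrightarrow> rank_pos G D"
proof -
  let ?P = "\<lambda>k. \<forall>F. effective G F \<and> div_degree G F = int k \<longrightarrow>
    equiv_to_effective G (\<lambda>v. D v - F v)"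
  obtain v0 where v0: "v0 \<in> verts G" using mg_graphD(3)[OF G] by blast
  have D_eff: "equiv_to_effective G D"
    using D div_equiv_refl unfolding equiv_to_effective_def by blast
  \<comment> \<open>Subtracting k chips at one vertex bounds k by the degree, so that
    \<open>GREATEST\<close> denotes an actual maximum.\<close>
  have bound: "k \<le> nat (div_degree G D)" if Pk: "?P k" for k
  proof -
    let ?F = "\<lambda>w. if w = v0 then int k else 0"
    obtain E where E: "effective G E" "div_equiv G (\<lambda>v. D v - ?F v) E"
      using Pk effective_single[OF G v0, of k] unfolding equiv_to_effective_def by blast
    have "div_degree G (\<lambda>v. D v - ?F v) = div_degree G D - div_degree G ?F"
      by (simp add: div_degree_def sum_subtractf)
    then have "div_degree G D = int k + div_degree G E"
      using div_equiv_degree[OF G E(2)] effective_single(2)[OF G v0, of k] by simp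
    then show ?thesis using effective_degree_nonneg[OF E(1)] by simp
  qed
  have P0: "?P 0"
  proof (intro allI impI)
    fix F assume F: "effective G F \<and> div_degree G F = int 0"
    then have "F v = 0" if "v \<in> verts G" for v
      using sum_nonneg_eq_0_iff[OF mg_graphD(1)[OF G], of F] that
      by (auto simp: effective_def div_degree_def)
    then have "div_equiv G (\<lambda>v. D v - F v) D"
      unfolding div_equiv_def by (intro exI[of _ "\<lambda>_. 0"]) simp
    then show "equiv_to_effective G (\<lambda>v. D v - F v)"
      using D unfolding equiv_to_effective_def by blast
  qed
  have P1: "?P 1" if R: "rank_pos G D"
  proof (intro allI impI)
    fix F assume F: "effective G F \<and> div_degree G F = int 1"
    have "\<exists>v\<in>verts G. F v \<noteq> 0"
    proof (rule ccontr)
      assume "\<not> (\<exists>v\<in>verts G. F v \<noteq> 0)"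
      then have "div_degree G F = 0" by (simp add: div_degree_def)
      with F show False by simp
    qed
    then obtain v where v: "v \<in> verts G" "F v \<noteq> 0" by blast
    then have "1 \<le> F v" using F by (force simp: effective_def)
    have "div_degree G F = F v + (\<Sum>w\<in>verts G - {v}. F w)"
      unfolding div_degree_def by (rule sum.remove[OF mg_graphD(1)[OF G] v(1)])
    moreover have "0 \<le> (\<Sum>w\<in>verts G - {v}. F w)"
      using F by (auto simp: effective_def intro: sum_nonneg)
    ultimately have Fv: "F v = 1" and "(\<Sum>w\<in>verts G - {v}. F w) = 0"
      using F \<open>1 \<le> F v\<close> by auto
    then have Fw: "F w = 0" if "w \<in> verts G" "w \<noteq> v" for w
      using sum_nonneg_eq_0_iff[of "verts G - {v}" F] mg_graphD(1)[OF G] F that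
      by (auto simp: effective_def)
    obtain E where E: "effective G E" "div_equiv G D E" "0 < E v"
      using R v(1) by (auto simp: rank_pos_def)
    have "effective G (\<lambda>w. E w - F w)"
      using E F Fv Fw unfolding effective_def divisor_def
      by (metis add_0 diff_0_right diff_ge_0_iff_ge zless_imp_add1_zle)
    moreover have "div_equiv G (\<lambda>v. D v - F v) (\<lambda>v. E v - F v)"
      using E(2) by (simp add: div_equiv_def)
    ultimately show "equiv_to_effective G (\<lambda>v. D v - F v)"
      unfolding equiv_to_effective_def by blast
  qed
  \<comment> \<open>The maximum may exceed 1, so all k chips are taken from v and returned to v
    afterwards.\<close>
  have pos: "rank_pos G D" if Pk: "?P k" "1 \<le> k" for k
    unfolding rank_pos_def
  proof
    fix v assume v: "v \<in> verts G"
    let ?F = "\<lambda>w. if w = v then int k else 0"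
    obtain E where E: "effective G E" "div_equiv G (\<lambda>v. D v - ?F v) E"
      using Pk effective_single[OF G v, of k] unfolding equiv_to_effective_def by blast
    have "effective G (\<lambda>w. E w + ?F w)"
      using E(1) v by (auto simp: effective_def divisor_def)
    moreover have "div_equiv G D (\<lambda>w. E w + ?F w)"
      using E(2) unfolding div_equiv_def by (simp add: algebra_simps)
    moreover have "0 < E v + ?F v" using E(1) v Pk(2) by (force simp: effective_def)
    ultimately show "\<exists>E. effective G E \<and> div_equiv G D E \<and> 0 < E v" by blast
  qed
  have "1 \<le> (GREATEST k. ?P k) \<longleftrightarrow> rank_pos G D"
  proof
    assume "1 \<le> (GREATEST k. ?P k)"
    with GreatestI_nat[of ?P 0, OF P0] bound show "rank_pos G D" using pos by blast
  next
    assume "rank_pos G D"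
    from P1[OF this] show "1 \<le> (GREATEST k. ?P k)"
      by (rule Greatest_le_nat) (use bound in blast)
  qed
  then show ?thesis using D_eff by (simp add: div_rank_def)
qed

lemma gonality_le:
  assumes "mg_graph G" "effective G D" "div_degree G D = int d" "rank_pos G D"
  shows "gonality G \<le> d"
  unfolding gonality_def
  using assms div_rank_ge_1_iff[OF assms(1,2)] by (intro Least_le exI[of _ D] conjI) auto

text \<open>This divisor is its own witness at every vertex; it makes the set under
  \<open>LEAST\<close> in \<open>gonality\<close> nonempty.\<close>

lemma all_ones:
  assumes "mg_graph G"
  shows "effective G (\<lambda>v. if v \<in> verts G then 1 else 0)"
    and "div_degree G (\<lambda>v. if v \<in> verts G then 1 else 0) = int (card (verts G))"
    and "rank_pos G (\<lambda>v. if v \<in> verts G then 1 else 0)"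
proof -
  let ?D = "\<lambda>v. if v \<in> verts G then 1 else 0 :: int"
  show eff: "effective G ?D" by (simp add: effective_def divisor_def)
  show "div_degree G ?D = int (card (verts G))" by (simp add: div_degree_def)
  show "rank_pos G ?D"
    unfolding rank_pos_def
  proof
    fix v assume "v \<in> verts G"
    then show "\<exists>E. effective G E \<and> div_equiv G ?D E \<and> 0 < E v"
      using eff div_equiv_refl by (intro exI[of _ ?D]) auto
  qed
qed

lemma gonality_le_card: "mg_graph G \<Longrightarrow> gonality G \<le> card (verts G)"
  by (rule gonality_le[OF _ all_ones])

lemma gonality_attained:
  assumes G: "mg_graph G"
  obtains D where "effective G D" "div_degree G D = int (gonality G)" "rank_pos G D"
proof -
  let ?P = "\<lambda>d. \<exists>D. effective G D \<and> div_degree G D = int d \<and> 1 \<le> div_rank G D"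
  have "?P (card (verts G))" using all_ones[OF G] div_rank_ge_1_iff[OF G] by blast
  then have "?P (LEAST d. ?P d)" by (rule LeastI)
  then show ?thesis using that div_rank_ge_1_iff[OF G] unfolding gonality_def by blast
qed

text \<open>Below degree k an effective divisor is alone in its class, so positive rank requires a
  chip of D on each of the at least k vertices.\<close>

lemma (in cut_bounded) gonality_ge:
  assumes "k \<le> card (verts G)"
  shows "k \<le> gonality G"
proof (rule ccontr)
  assume less: "\<not> k \<le> gonality G"
  obtain D where D: "effective G D" "div_degree G D = int (gonality G)" "rank_pos G D"
    using gonality_attained[OF G] .
  have "1 \<le> D v" if v: "v \<in> verts G" for v
  proof -
    obtain E where "effective G E" "div_equiv G D E" "0 < E v"
      using D(3) v by (auto simp: rank_pos_def)
    then show ?thesis using equiv_lt_imp_eq[OF D(1), of E] D(2) less by auto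
  qed
  then have "(\<Sum>v\<in>verts G. 1) \<le> div_degree G D"
    unfolding div_degree_def by (rule sum_mono)
  then show False using D(2) less assms by simp
qed

section \<open>Pulling back a vertex of a tree\<close>

lemma morphism_edge:
  assumes "is_morphism G T \<phi>" "e \<in> edges G" "ends G e = {u, v}" "emap \<phi> e = Inr e'"
  shows "e' \<in> edges T" "ends T e' = {vmap \<phi> u, vmap \<phi> v}" "vmap \<phi> u \<noteq> vmap \<phi> v"
proof -
  have *: "if vmap \<phi> u = vmap \<phi> v then emap \<phi> e = Inl (vmap \<phi> u)
    else \<exists>e'\<in>edges T. emap \<phi> e = Inr e' \<and> ends T e' = {vmap \<phi> u, vmap \<phi> v}"
    using assms(1-3) unfolding is_morphism_def by blast
  then show "vmap \<phi> u \<noteq> vmap \<phi> v" using assms(4) by auto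
  with * show "e' \<in> edges T" "ends T e' = {vmap \<phi> u, vmap \<phi> v}" using assms(4) by auto
qed

lemma vertex_mult_eq:
  assumes "is_harmonic G T \<phi>" "v \<in> verts G" "e' \<in> incident_edges T (vmap \<phi> v)"
  shows "vertex_mult G T \<phi> v = edge_mult G \<phi> v e'"
proof -
  have "(SOME e'. e' \<in> incident_edges T (vmap \<phi> v)) \<in> incident_edges T (vmap \<phi> v)"
    using assms(3) by (rule someI)
  then show ?thesis
    using assms unfolding vertex_mult_def is_harmonic_def by (metis empty_iff)
qed

definition pullback ::
  "('v, 'e) mgraph \<Rightarrow> ('w, 'f) mgraph \<Rightarrow> ('v, 'e, 'w, 'f) mg_map \<Rightarrow> 'w \<Rightarrow> 'v \<Rightarrow> int" where
  "pullback G T \<phi> x v =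
    (if v \<in> verts G \<and> vmap \<phi> v = x then int (vertex_mult G T \<phi> v) else 0)"

lemma effective_pullback: "effective G (pullback G T \<phi> x)"
  by (simp add: effective_def divisor_def pullback_def)

text \<open>Removing the edge \<open>e'\<close> splits the tree, and firing the preimage of the side of \<open>x\<close> moves
  exactly one chip along each edge over \<open>e'\<close>.\<close>

lemma pullback_equiv_edge:
  assumes G: "mg_graph G" and T: "is_tree T" and H: "is_harmonic G T \<phi>"
    and e': "e' \<in> edges T" "ends T e' = {x, y}"
  shows "div_equiv G (pullback G T \<phi> x) (pullback G T \<phi> y)"
proof -
  have gT: "mg_graph T" and mor: "is_morphism G T \<phi>"
    using T H by (auto simp: is_tree_def is_harmonic_def)
  have "x \<noteq> y" using mg_graphD(6)[OF gT e'(1)] e'(2) by auto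
  obtain X0 where X0: "X0 \<subseteq> verts T" "cut_edges T X0 = {e'}"
    using tree_bridge[OF T e'(1)] .
  \<comment> \<open>The bridge gives a cut without orientation; X is the side containing x.\<close>
  define X where "X = (if x \<in> X0 then X0 else verts T - X0)"
  have "e' \<in> cut_edges T X0" using X0 by simp
  then have X: "x \<in> X" "y \<notin> X"
    using e' mg_graphD(5)[OF gT e'(1)] by (auto simp: X_def cut_edges_def)
  have "cut_edges T (verts T - X0) = cut_edges T X0"
    using mg_graphD(5)[OF gT] by (fastforce simp: cut_edges_def)
  then have cut: "cut_edges T X = {e'}" using X0 by (simp add: X_def)
  define f where "f v = (if vmap \<phi> v \<in> X then 1 else 0 :: int)" for v
  \<comment> \<open>The difference of f along an edge over e', seen from its end over x (+1) or over
    y (-1).\<close>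
  define s where "s v = (if vmap \<phi> v = x then 1 else if vmap \<phi> v = y then - 1 else 0 :: int)" for v
  have "pullback G T \<phi> x v - pullback G T \<phi> y v = lap G f v" if v: "v \<in> verts G" for v
  proof -
    have "lap G f v = (\<Sum>e\<in>incident_edges G v. if emap \<phi> e = Inr e' then s v else 0)"
      unfolding lap_def
    proof (rule sum.cong[OF refl])
      fix e assume "e \<in> incident_edges G v"
      then have e: "e \<in> edges G" "v \<in> ends G e" by (auto simp: incident_edges_def)
      obtain w where w: "ends G e = {v, w}" "v \<noteq> w" using edge_ends_atE[OF G e] .
      have "f v - f w = (if emap \<phi> e = Inr e' then s v else 0)"
      proof (cases "emap \<phi> e = Inr e'")
        case True
        from morphism_edge(2)[OF mor e(1) w(1) True] e'(2) \<open>x \<noteq> y\<close> X True show ?thesis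
          by (auto simp: f_def s_def doubleton_eq_iff)
      next
        case False
        \<comment> \<open>An edge not over e' is contracted or lies over another edge of T, which
          does not cross X.\<close>
        have "vmap \<phi> v \<in> X \<longleftrightarrow> vmap \<phi> w \<in> X"
        proof (cases "vmap \<phi> v = vmap \<phi> w")
          case neq: False
          then obtain e2 where e2: "e2 \<in> edges T" "emap \<phi> e = Inr e2"
              "ends T e2 = {vmap \<phi> v, vmap \<phi> w}"
            using mor e(1) w(1) unfolding is_morphism_def by metis
          then have "e2 \<notin> cut_edges T X" using False cut by auto
          with e2 show ?thesis by (auto simp: cut_edges_def)
        qed simp
        then show ?thesis using False by (simp add: f_def)
      qed
      then show "(\<Sum>w\<in>ends G e. f v - f w) = (if emap \<phi> e = Inr e' then s v else 0)"
        using w by simp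
    qed
    also have "\<dots> = s v * int (edge_mult G \<phi> v e')"
      unfolding sum.inter_filter[OF finite_incident[OF G], symmetric]
      by (simp add: edge_mult_def incident_edges_def conj_assoc)
    also have "\<dots> = pullback G T \<phi> x v - pullback G T \<phi> y v"
      using v vertex_mult_eq[OF H v, of e'] e' \<open>x \<noteq> y\<close>
      by (auto simp: s_def pullback_def incident_edges_def)
    finally show ?thesis by simp
  qed
  then show ?thesis using div_equiv_iff_lap[OF G] by blast
qed

lemma pullback_equiv:
  assumes G: "mg_graph G" and T: "is_tree T" and H: "is_harmonic G T \<phi>"
    and xy: "x \<in> verts T" "y \<in> verts T"
  shows "div_equiv G (pullback G T \<phi> x) (pullback G T \<phi> y)"
proof -
  have "(x, y) \<in> (adj_rel T)\<^sup>*"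
    using T xy by (simp add: is_tree_def mg_graph_def mg_connected_def)
  then show ?thesis
  proof (induction rule: rtrancl_induct)
    case base
    show ?case by (rule div_equiv_refl)
  next
    case (step y z)
    then obtain e' where "e' \<in> edges T" "ends T e' = {y, z}" by (auto simp: adj_rel_def)
    from div_equiv_trans[OF G step.IH pullback_equiv_edge[OF G T H this]] show ?case .
  qed
qed

text \<open>Every edge over e' has exactly one end over x, because x and y differ.\<close>

lemma pullback_degree:
  assumes G: "mg_graph G" and T: "mg_graph T" and H: "is_harmonic G T \<phi>"
    and e': "e' \<in> edges T" "ends T e' = {x, y}"
  shows "div_degree G (pullback G T \<phi> x) = int (card {e \<in> edges G. emap \<phi> e = Inr e'})"
proof -
  have mor: "is_morphism G T \<phi>" using H by (simp add: is_harmonic_def)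
  have "x \<noteq> y" using mg_graphD(6)[OF T e'(1)] e'(2) by auto
  let ?A = "{v \<in> verts G. vmap \<phi> v = x}"
  have "div_degree G (pullback G T \<phi> x) = (\<Sum>v\<in>?A. int (vertex_mult G T \<phi> v))"
    unfolding div_degree_def pullback_def sum.inter_filter[OF mg_graphD(1)[OF G]]
    by (rule sum.cong) auto
  also have "\<dots> = (\<Sum>v\<in>?A. \<Sum>e\<in>incident_edges G v. if emap \<phi> e = Inr e' then 1 else 0)"
  proof (rule sum.cong[OF refl])
    fix v assume v: "v \<in> ?A"
    then have "vertex_mult G T \<phi> v = edge_mult G \<phi> v e'"
      using e' by (intro vertex_mult_eq[OF H]) (auto simp: incident_edges_def)
    also have "int (edge_mult G \<phi> v e') =
        (\<Sum>e\<in>incident_edges G v. if emap \<phi> e = Inr e' then 1 else 0)"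
      unfolding sum.inter_filter[OF finite_incident[OF G], symmetric]
      by (simp add: edge_mult_def incident_edges_def conj_assoc)
    finally show "int (vertex_mult G T \<phi> v) =
        (\<Sum>e\<in>incident_edges G v. if emap \<phi> e = Inr e' then 1 else 0)" .
  qed
  also have "\<dots> = (\<Sum>e\<in>edges G. \<Sum>v\<in>ends G e \<inter> ?A. if emap \<phi> e = Inr e' then 1 else 0)"
    by (rule sum_incident_edges_swap[OF G]) auto
  also have "\<dots> = (\<Sum>e\<in>edges G. if emap \<phi> e = Inr e' then 1 else 0)"
  proof (rule sum.cong[OF refl])
    fix e assume e: "e \<in> edges G"
    show "(\<Sum>v\<in>ends G e \<inter> ?A. if emap \<phi> e = Inr e' then 1 else 0) =
        (if emap \<phi> e = Inr e' then 1 else 0 :: int)"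
    proof (cases "emap \<phi> e = Inr e'")
      case True
      obtain u v where uv: "ends G e = {u, v}" "u \<noteq> v" "u \<in> verts G" "v \<in> verts G"
        using edge_endsE[OF G e] .
      have "{x, y} = {vmap \<phi> u, vmap \<phi> v}"
        using morphism_edge(2)[OF mor e uv(1) True] e'(2) by simp
      then have "ends G e \<inter> ?A = {u} \<or> ends G e \<inter> ?A = {v}"
        using uv \<open>x \<noteq> y\<close> by (auto simp: doubleton_eq_iff)
      then show ?thesis by auto
    qed simp
  qed
  also have "\<dots> = int (card {e \<in> edges G. emap \<phi> e = Inr e'})"
    unfolding sum.inter_filter[OF mg_graphD(2)[OF G], symmetric] by simp
  finally show ?thesis .
qed

text \<open>All fibres are equivalent, and nondegeneracy puts a chip on v in the fibre through
  v.\<close>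

lemma gonality_le_morphism_degree:
  assumes G: "mg_graph G" and T: "is_tree T" and H: "is_harmonic G T \<phi>"
    and nd: "nondegenerate G T \<phi>" and edge: "edges T \<noteq> {}"
  shows "gonality G \<le> morphism_degree G T \<phi>"
proof -
  have gT: "mg_graph T" using T by (simp add: is_tree_def)
  define e' where "e' = (SOME e'. e' \<in> edges T)"
  have e': "e' \<in> edges T" unfolding e'_def using edge by (simp add: some_in_eq)
  obtain x y where x: "ends T e' = {x, y}" "x \<in> verts T" using edge_endsE[OF gT e'] by metis
  have "rank_pos G (pullback G T \<phi> x)"
    unfolding rank_pos_def
  proof
    fix v assume v: "v \<in> verts G"
    then have "vmap \<phi> v \<in> verts T" using H by (simp add: is_harmonic_def is_morphism_def)
    then have "div_equiv G (pullback G T \<phi> x) (pullback G T \<phi> (vmap \<phi> v))"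
      by (rule pullback_equiv[OF G T H x(2)])
    moreover have "0 < pullback G T \<phi> (vmap \<phi> v) v"
      using v nd by (simp add: pullback_def nondegenerate_def)
    ultimately show "\<exists>E. effective G E \<and> div_equiv G (pullback G T \<phi> x) E \<and> 0 < E v"
      using effective_pullback by metis
  qed
  moreover have "div_degree G (pullback G T \<phi> x) = int (morphism_degree G T \<phi>)"
    using pullback_degree[OF G gT H e' x(1)] edge by (simp add: morphism_degree_def e'_def)
  ultimately show ?thesis by (intro gonality_le[OF G effective_pullback])
qed

text \<open>For degree 3 this leads to two vertices with three edges, the graph excluded in the
  theorem.\<close>

lemma morphism_degree_two_vertices:
  assumes G: "mg_graph G" and T: "is_tree T" and mor: "is_morphism G T \<phi>"
    and two: "card (verts G) = 2" and pos: "0 < morphism_degree G T \<phi>"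
  shows "morphism_degree G T \<phi> = card (edges G)"
proof -
  have edge: "edges T \<noteq> {}" using pos by (auto simp: morphism_degree_def)
  define e' where "e' = (SOME e'. e' \<in> edges T)"
  have e': "e' \<in> edges T" unfolding e'_def using edge by (simp add: some_in_eq)
  have deg: "morphism_degree G T \<phi> = card {e \<in> edges G. emap \<phi> e = Inr e'}"
    using edge by (simp add: morphism_degree_def e'_def)
  obtain a b where ab: "verts G = {a, b}" "a \<noteq> b" using two by (auto simp: card_2_iff)
  have ends: "ends G e = {a, b}" if "e \<in> edges G" for e
    using mg_graphD(1,5,6)[OF G] that ab two by (metis card_subset_eq)
  obtain e0 where e0: "e0 \<in> edges G" "emap \<phi> e0 = Inr e'"
    using pos unfolding deg by (auto simp: card_gt_0_iff)
  note m = morphism_edge[OF mor e0(1) ends[OF e0(1)] e0(2)]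
  obtain X where X: "X \<subseteq> verts T" "cut_edges T X = {e'}" using tree_bridge[OF T e'] .
  have "emap \<phi> e = Inr e'" if e: "e \<in> edges G" for e
  proof -
    obtain e2 where e2: "e2 \<in> edges T" "emap \<phi> e = Inr e2" "ends T e2 = {vmap \<phi> a, vmap \<phi> b}"
      using mor e ends[OF e] m(3) unfolding is_morphism_def by metis
    \<comment> \<open>An edge parallel to e' crosses the same cut, so a bridge has no other parallel
      edge.\<close>
    have "e' \<in> cut_edges T X" using X by simp
    then have "e2 \<in> cut_edges T X" using e2 m(2) by (simp add: cut_edges_def)
    then show ?thesis using X e2 by simp
  qed
  then have "{e \<in> edges G. emap \<phi> e = Inr e'} = edges G" by blast
  then show ?thesis using deg by simp
qed

section \<open>Quotients of a graph\<close>

text \<open>Collapsing the fibres of \<open>\<psi>\<close> and identifying parallel edges. An edge of the quotient is the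
  code of its set of ends, whence \<open>ends = set_decode\<close>.\<close>

definition quotient_graph :: "('v, 'e) mgraph \<Rightarrow> ('v \<Rightarrow> nat) \<Rightarrow> (nat, nat) mgraph" where
  "quotient_graph G \<psi> = \<lparr>verts = \<psi> ` verts G,
    edges = set_encode ` {\<psi> ` ends G e | e. e \<in> edges G \<and> card (\<psi> ` ends G e) = 2},
    ends = set_decode\<rparr>"

definition quotient_map ::
  "('v, 'e) mgraph \<Rightarrow> ('v \<Rightarrow> nat) \<Rightarrow> ('v, 'e, nat, nat) mg_map" where
  "quotient_map G \<psi> = \<lparr>vmap = \<psi>,
    emap = (\<lambda>e. if card (\<psi> ` ends G e) = 2 then Inr (set_encode (\<psi> ` ends G e))
      else Inl (the_elem (\<psi> ` ends G e)))\<rparr>"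

lemma quotient_graph_sel:
  "verts (quotient_graph G \<psi>) = \<psi> ` verts G" "ends (quotient_graph G \<psi>) = set_decode"
  "vmap (quotient_map G \<psi>) = \<psi>"
  by (simp_all add: quotient_graph_def quotient_map_def)

lemma quotient_edgeE:
  assumes "e' \<in> edges (quotient_graph G \<psi>)"
  obtains e where "e \<in> edges G" "card (\<psi> ` ends G e) = 2" "e' = set_encode (\<psi> ` ends G e)"
    "set_decode e' = \<psi> ` ends G e"
proof -
  obtain e where "e \<in> edges G" "card (\<psi> ` ends G e) = 2" "e' = set_encode (\<psi> ` ends G e)"
    using assms by (auto simp: quotient_graph_def)
  moreover then have "finite (\<psi> ` ends G e)" by (simp add: card_ge_0_finite)
  ultimately show ?thesis using that by simp
qed

lemma quotient_edgeI:
  assumes "e \<in> edges G" "card (\<psi> ` ends G e) = 2"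
  shows "set_encode (\<psi> ` ends G e) \<in> edges (quotient_graph G \<psi>)"
    and "set_decode (set_encode (\<psi> ` ends G e)) = \<psi> ` ends G e"
proof -
  show "set_encode (\<psi> ` ends G e) \<in> edges (quotient_graph G \<psi>)"
    using assms by (auto simp: quotient_graph_def)
  have "finite (\<psi> ` ends G e)" using assms(2) by (simp add: card_ge_0_finite)
  then show "set_decode (set_encode (\<psi> ` ends G e)) = \<psi> ` ends G e" by simp
qed

lemma emap_quotient_eq_Inr_iff:
  assumes G: "mg_graph G" and e: "e \<in> edges G" and S: "card S = 2"
  shows "emap (quotient_map G \<psi>) e = Inr (set_encode S) \<longleftrightarrow> \<psi> ` ends G e = S"
proof -
  have "finite (\<psi> ` ends G e)" "finite S"
    using mg_graphD(7)[OF G e] S by (auto intro: card_ge_0_finite)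
  then show ?thesis using S by (auto simp: quotient_map_def set_encode_eq)
qed

lemma mg_graph_quotient:
  assumes G: "mg_graph G"
  shows "mg_graph (quotient_graph G \<psi>)"
proof -
  let ?Q = "quotient_graph G \<psi>"
  have ends: "ends ?Q e' \<subseteq> verts ?Q \<and> card (ends ?Q e') = 2" if "e' \<in> edges ?Q" for e'
    using quotient_edgeE[OF that] mg_graphD(5)[OF G]
    by (metis image_mono quotient_graph_sel(1,2))
  have "cut_edges ?Q A \<noteq> {}" if A: "A \<subseteq> verts ?Q" "A \<noteq> {}" "A \<noteq> verts ?Q" for A
  proof -
    \<comment> \<open>An edge of G crossing the preimage of A is not contracted, and its image
      crosses A.\<close>
    define B where "B = {v \<in> verts G. \<psi> v \<in> A}"
    have AB: "A = \<psi> ` B" using A(1) by (auto simp: B_def quotient_graph_sel)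
    have "B \<subseteq> verts G" by (auto simp: B_def)
    moreover have "B \<noteq> {}" using A(2) AB by blast
    moreover have "B \<noteq> verts G" using A(3) AB by (metis quotient_graph_sel(1))
    ultimately have "cut_edges G B \<noteq> {}" by (rule connected_cut[OF G])
    then obtain e x y where e: "e \<in> edges G" "x \<in> ends G e" "x \<in> B" "y \<in> ends G e" "y \<notin> B"
      by (auto simp: cut_edges_def)
    have y: "y \<in> verts G" using mg_graphD(5)[OF G e(1)] e(4) by blast
    have xy: "\<psi> x \<in> A" "\<psi> y \<notin> A" using e y by (auto simp: B_def)
    have "ends G e = {x, y}" using edge_ends_eq[OF G e(1,2,4)] e by blast
    then have im: "\<psi> ` ends G e = {\<psi> x, \<psi> y}" by simp
    moreover have "\<psi> x \<noteq> \<psi> y" using xy by metis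
    ultimately have "card (\<psi> ` ends G e) = 2" by simp
    from quotient_edgeI[OF e(1) this]
    have "set_encode (\<psi> ` ends G e) \<in> cut_edges ?Q A"
      unfolding cut_edges_def using im xy by (simp add: quotient_graph_sel)
    then show ?thesis by blast
  qed
  then have "mg_connected ?Q"
    using mg_connected_iff_cut[OF ends] mg_graphD(3)[OF G] by (simp add: quotient_graph_sel)
  moreover have "finite (edges ?Q)"
  proof (rule finite_subset)
    show "edges ?Q \<subseteq> (\<lambda>e. set_encode (\<psi> ` ends G e)) ` edges G"
      by (auto simp: quotient_graph_def)
  qed (use mg_graphD(2)[OF G] in simp)
  ultimately show ?thesis
    using ends mg_graphD(1)[OF G] by (simp add: mg_graph_def quotient_graph_sel(1))
qed

lemma is_morphism_quotient:
  assumes G: "mg_graph G"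
  shows "is_morphism G (quotient_graph G \<psi>) (quotient_map G \<psi>)"
  unfolding is_morphism_def quotient_graph_sel
proof (intro conjI ballI allI impI)
  fix e u v assume e: "e \<in> edges G" "ends G e = {u, v}"
  then have im: "\<psi> ` ends G e = {\<psi> u, \<psi> v}" by simp
  show "if \<psi> u = \<psi> v then emap (quotient_map G \<psi>) e = Inl (\<psi> u)
    else \<exists>e'\<in>edges (quotient_graph G \<psi>). emap (quotient_map G \<psi>) e = Inr e' \<and>
      set_decode e' = {\<psi> u, \<psi> v}"
  proof (cases "\<psi> u = \<psi> v")
    case True
    then show ?thesis by (simp add: quotient_map_def im)
  next
    case False
    then have c: "card (\<psi> ` ends G e) = 2" unfolding im by simp
    then have "emap (quotient_map G \<psi>) e = Inr (set_encode (\<psi> ` ends G e))"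
      by (simp add: quotient_map_def)
    with quotient_edgeI[OF e(1) c] False im show ?thesis by metis
  qed
qed simp

text \<open>Since A is a union of fibres, crossing A can be read off the image of an edge. The image
  of A thus has a one-edge cut, and every edge of the quotient is a bridge.\<close>

lemma is_tree_quotient:
  assumes G: "mg_graph G"
    and cut: "\<And>e. e \<in> edges G \<Longrightarrow> card (\<psi> ` ends G e) = 2 \<Longrightarrow>
      \<exists>A \<subseteq> verts G. (\<forall>x\<in>verts G. \<forall>y\<in>verts G. \<psi> x = \<psi> y \<longrightarrow> x \<in> A \<longrightarrow> y \<in> A) \<and>
        cut_edges G A = {e' \<in> edges G. \<psi> ` ends G e' = \<psi> ` ends G e}"
  shows "is_tree (quotient_graph G \<psi>)"
proof (rule is_tree_if_bridges[OF mg_graph_quotient[OF G]])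
  let ?Q = "quotient_graph G \<psi>"
  fix f assume "f \<in> edges ?Q"
  then obtain e where e: "e \<in> edges G" "card (\<psi> ` ends G e) = 2" "f = set_encode (\<psi> ` ends G e)"
    by (rule quotient_edgeE) (rule that)
  from cut[OF e(1,2)] obtain A where A: "A \<subseteq> verts G"
      "\<forall>x\<in>verts G. \<forall>y\<in>verts G. \<psi> x = \<psi> y \<longrightarrow> x \<in> A \<longrightarrow> y \<in> A"
    and cutA: "cut_edges G A = {e' \<in> edges G. \<psi> ` ends G e' = \<psi> ` ends G e}"
    by (elim exE conjE)
  have sat: "\<psi> x \<in> \<psi> ` A \<longleftrightarrow> x \<in> A" if x: "x \<in> verts G" for x
  proof
    assume "\<psi> x \<in> \<psi> ` A"
    then obtain y where "y \<in> A" "\<psi> x = \<psi> y" by blast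
    then show "x \<in> A" using A x by (metis subsetD)
  qed simp
  have iff: "set_encode (\<psi> ` ends G e') \<in> cut_edges ?Q (\<psi> ` A) \<longleftrightarrow> \<psi> ` ends G e' = \<psi> ` ends G e"
    if e': "e' \<in> edges G" "card (\<psi> ` ends G e') = 2" for e'
  proof -
    have "set_encode (\<psi> ` ends G e') \<in> cut_edges ?Q (\<psi> ` A) \<longleftrightarrow>
        \<psi> ` ends G e' \<inter> \<psi> ` A \<noteq> {} \<and> \<psi> ` ends G e' - \<psi> ` A \<noteq> {}"
      using quotient_edgeI[OF e'] by (simp add: cut_edges_def quotient_graph_sel)
    also have "\<dots> \<longleftrightarrow> (\<exists>x\<in>ends G e'. \<psi> x \<in> \<psi> ` A) \<and> (\<exists>x\<in>ends G e'. \<psi> x \<notin> \<psi> ` A)"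
      by blast
    also have "\<dots> \<longleftrightarrow> (\<exists>x\<in>ends G e'. x \<in> A) \<and> (\<exists>x\<in>ends G e'. x \<notin> A)"
      using sat mg_graphD(5)[OF G e'(1)] by (meson subsetD)
    also have "\<dots> \<longleftrightarrow> e' \<in> cut_edges G A"
      using e'(1) unfolding cut_edges_def by blast
    finally show ?thesis using cutA e'(1) by simp
  qed
  have "cut_edges ?Q (\<psi> ` A) = {f}"
  proof (rule set_eqI)
    fix g
    show "g \<in> cut_edges ?Q (\<psi> ` A) \<longleftrightarrow> g \<in> {f}"
    proof
      assume g: "g \<in> cut_edges ?Q (\<psi> ` A)"
      then have "g \<in> edges ?Q" by (simp add: cut_edges_def)
      then obtain e' where "e' \<in> edges G" "card (\<psi> ` ends G e') = 2" "g = set_encode (\<psi> ` ends G e')"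
        by (rule quotient_edgeE) (rule that)
      with iff[of e'] g e(3) show "g \<in> {f}" by simp
    next
      assume "g \<in> {f}"
      with iff[OF e(1,2)] e(3) show "g \<in> cut_edges ?Q (\<psi> ` A)" by simp
    qed
  qed
  moreover have "\<psi> ` A \<subseteq> verts ?Q" using A(1) by (auto simp: quotient_graph_sel)
  ultimately show "\<exists>X \<subseteq> verts ?Q. cut_edges ?Q X = {f}" by blast
qed

section \<open>The morphism defined by a divisor\<close>

text \<open>The analogue of a g^1_k on a curve: the members of the class of D will be the fibres of
  the morphism.\<close>

locale pencil = cut_bounded +
  fixes D :: "'a \<Rightarrow> int"
  assumes D: "effective G D" "div_degree G D = int k" "rank_pos G D"
begin

text \<open>By \<open>equiv_common_support\<close> the chosen divisor is the only candidate. Hence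
  \<open>rep\<close> is constant on each support, and its values label the fibres.\<close>

definition rep :: "'a \<Rightarrow> 'a \<Rightarrow> int" where
  "rep v = (SOME E. effective G E \<and> div_equiv G D E \<and> 0 < E v)"

lemma rep:
  assumes "v \<in> verts G"
  shows "effective G (rep v)" "div_equiv G D (rep v)" "0 < rep v v" "div_degree G (rep v) = int k"
proof -
  have "\<exists>E. effective G E \<and> div_equiv G D E \<and> 0 < E v"
    using assms D(3) by (simp add: rank_pos_def)
  then have "effective G (rep v) \<and> div_equiv G D (rep v) \<and> 0 < rep v v"
    unfolding rep_def by (rule someI_ex)
  then show "effective G (rep v)" "div_equiv G D (rep v)" "0 < rep v v" by simp_all
  then show "div_degree G (rep v) = int k" using div_equiv_degree[OF G] D(2) by metis
qed

lemma rep_equiv: "u \<in> verts G \<Longrightarrow> v \<in> verts G \<Longrightarrow> div_equiv G (rep u) (rep v)"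
  using div_equiv_trans[OF G div_equiv_sym[OF G rep(2)] rep(2)] .

lemma rep_eqI:
  assumes "u \<in> verts G" "v \<in> verts G" "0 < rep u v"
  shows "rep v = rep u"
  by (rule equiv_common_support[OF rep(1) rep(1) _ rep_equiv _ rep(3)]) (use assms rep(4) in auto)

text \<open>The potential from \<open>rep u\<close> to \<open>rep v\<close> is fired from both
  sides: its maximum set sends out exactly \<open>rep u\<close>, its minimum set exactly
  \<open>rep v\<close>. Since f drops by 1 along e0, these two sets are complementary and share
  their cut.\<close>

lemma edge_cut:
  assumes e0: "e0 \<in> edges G" "ends G e0 = {u, v}" and neq: "rep u \<noteq> rep v"
  obtains A where "A \<subseteq> verts G"
    "\<And>x y. x \<in> verts G \<Longrightarrow> y \<in> verts G \<Longrightarrow> rep x = rep y \<Longrightarrow> x \<in> A \<Longrightarrow> y \<in> A"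
    "\<And>e. e \<in> edges G \<Longrightarrow> e \<in> cut_edges G A \<longleftrightarrow> rep ` ends G e = {rep u, rep v}"
    "card (cut_edges G A) = k"
    "\<And>x. x \<in> verts G \<Longrightarrow> rep x = rep u \<Longrightarrow>
      int (card (incident_edges G x \<inter> cut_edges G A)) = rep x x"
proof -
  have uv: "u \<in> verts G" "v \<in> verts G" using mg_graphD(5)[OF G e0(1)] e0(2) by auto
  obtain f where lap: "\<And>w. w \<in> verts G \<Longrightarrow> rep u w - rep v w = lap G f w"
    using rep_equiv[OF uv] div_equiv_iff_lap[OF G] by blast
  have lap': "rep v w - rep u w = lap G (\<lambda>x. - f x) w" if "w \<in> verts G" for w
    unfolding lap_uminus lap[OF that, symmetric] by simp
  have le: "div_degree G (rep x) \<le> int k" if "x \<in> verts G" for x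
    using rep(4)[OF that] by simp
  note eff = rep(1)[OF uv(1)] rep(1)[OF uv(2)]
  \<comment> \<open>The chip of \<open>rep u\<close> at u makes f maximal there; the chip of
    \<open>rep v\<close> at v makes it minimal.\<close>
  have max: "f w \<le> f u" if "w \<in> verts G" for w
    by (rule support_maximal[OF eff le[OF uv(1)] lap uv(1) rep(3)[OF uv(1)] that])
  have min: "- f w \<le> - f v" if "w \<in> verts G" for w
    by (rule support_maximal[OF eff(2,1) le[OF uv(2)] lap' uv(2) rep(3)[OF uv(2)] that])
  have "f v < f u"
  proof (rule ccontr)
    assume "\<not> f v < f u"
    then have const: "f x = f u" if "x \<in> verts G" for x
      using max[OF that] min[OF that] max[OF uv(2)] by linarith
    have "rep u = rep v"
    proof (rule effective_eqI[OF eff])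
      fix w assume w: "w \<in> verts G"
      have "lap G f w = 0" by (rule lap_constant[OF _ w]) (simp add: const)
      then show "rep u w = rep v w" using lap[OF w] by simp
    qed
    with neq show False by simp
  qed
  define A where "A = {w \<in> verts G. f w = f u}"
  define B where "B = {w \<in> verts G. - f w = - f v}"
  note fire = argmax_firing[OF G cut_ge eff le[OF uv(1)] lap max uv(1) refl uv(2) \<open>f v < f u\<close>]
  have outA: "rep u w = int (card (incident_edges G w \<inter> cut_edges G A))" if "w \<in> A" for w
    unfolding A_def by (rule fire(3)) (assumption | rule that[unfolded A_def])+
  have drop: "f w = f u - 1" if "e \<in> cut_edges G A" "w \<in> ends G e - A" for e w
    unfolding A_def by (rule fire(4)) (assumption | rule that[unfolded A_def])+
  have cardA: "card (cut_edges G A) = k" unfolding A_def by (rule fire(5))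
  have "- f u < - f v" using \<open>f v < f u\<close> by simp
  note fire' = argmax_firing[OF G cut_ge eff(2,1) le[OF uv(2)] lap' min uv(2) refl uv(1) this]
  have outB: "rep v w = int (card (incident_edges G w \<inter> cut_edges G B))" if "w \<in> B" for w
    unfolding B_def by (rule fire'(3)) (assumption | rule that[unfolded B_def])+
  have "u \<in> A" "v \<notin> A" using uv \<open>f v < f u\<close> by (auto simp: A_def)
  then have "e0 \<in> cut_edges G A" using e0 by (simp add: cut_edges_def)
  then have fv: "f v = f u - 1" using drop[of e0 v] e0(2) \<open>v \<notin> A\<close> by simp
  \<comment> \<open>The minimum is the maximum minus 1, so f takes only two values.\<close>
  have B: "w \<in> B \<longleftrightarrow> w \<notin> A" if w: "w \<in> verts G" for w
    using max[OF w] min[OF w] fv w by (auto simp: A_def B_def)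
  \<comment> \<open>Both g, leading from \<open>rep x\<close> to \<open>rep u\<close>, and f + g,
    leading on to \<open>rep v\<close>, are maximal at every chip of \<open>rep x\<close>, in
    particular at x and y. Subtraction gives f x = f y.\<close>
  have sat: "y \<in> A" if xy: "x \<in> verts G" "y \<in> verts G" "rep x = rep y" and x: "x \<in> A" for x y
  proof -
    obtain g where g: "\<And>w. w \<in> verts G \<Longrightarrow> rep x w - rep u w = lap G g w"
      using rep_equiv[OF xy(1) uv(1)] div_equiv_iff_lap[OF G] by blast
    have h: "rep x w - rep v w = lap G (\<lambda>z. f z - (- g z)) w" if "w \<in> verts G" for w
      unfolding lap_diff lap_uminus g[OF that, symmetric] lap[OF that, symmetric] by simp
    have m: "g z \<le> g w" if "w \<in> verts G" "0 < rep x w" "z \<in> verts G" for w z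
      by (rule support_maximal[OF rep(1)[OF xy(1)] eff(1) le[OF xy(1)] g that])
    have m': "f z - (- g z) \<le> f w - (- g w)"
      if "w \<in> verts G" "0 < rep x w" "z \<in> verts G" for w z
      by (rule support_maximal[OF rep(1)[OF xy(1)] eff(2) le[OF xy(1)] h that])
    have pos: "0 < rep x x" "0 < rep x y" using rep(3)[OF xy(1)] rep(3)[OF xy(2)] xy(3) by simp_all
    have "g x = g y" using m[OF xy(1) pos(1) xy(2)] m[OF xy(2) pos(2) xy(1)] by simp
    moreover have "f x - (- g x) = f y - (- g y)"
      using m'[OF xy(1) pos(1) xy(2)] m'[OF xy(2) pos(2) xy(1)] by simp
    ultimately show ?thesis using x xy by (simp add: A_def)
  qed
  have cut: "e \<in> cut_edges G A \<longleftrightarrow> rep ` ends G e = {rep u, rep v}" if e: "e \<in> edges G" for e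
  proof
    assume c: "e \<in> cut_edges G A"
    then obtain x y where xy: "x \<in> ends G e" "x \<in> A" "y \<in> ends G e" "y \<notin> A"
      by (auto simp: cut_edges_def)
    then have ends: "ends G e = {x, y}" using edge_ends_eq[OF G e, of x y] by blast
    have V: "x \<in> verts G" "y \<in> verts G" using mg_graphD(5)[OF G e] xy by auto
    have "e \<in> incident_edges G x \<inter> cut_edges G A" using c e xy by (simp add: incident_edges_def)
    \<comment> \<open>The edge e is counted at x, so x carries a chip of
      \<open>rep u\<close>.\<close>
    then have "0 < rep u x" using outA[OF xy(2)] finite_cut_edges[OF G]
      by (metis card_gt_0_iff empty_iff finite_Int of_nat_0_less_iff)
    then have x: "rep x = rep u" using rep_eqI uv V by blast
    have "y \<in> B" "x \<notin> B" using B V xy by auto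
    then have "e \<in> incident_edges G y \<inter> cut_edges G B"
      using e xy by (auto simp: incident_edges_def cut_edges_def)
    then have "0 < rep v y" using outB[OF \<open>y \<in> B\<close>] finite_cut_edges[OF G]
      by (metis card_gt_0_iff empty_iff finite_Int of_nat_0_less_iff)
    then have "rep y = rep v" using rep_eqI uv V by blast
    with x ends show "rep ` ends G e = {rep u, rep v}" by simp
  next
    assume im: "rep ` ends G e = {rep u, rep v}"
    then have "rep u \<in> rep ` ends G e" "rep v \<in> rep ` ends G e" by simp_all
    then obtain x y where xy: "x \<in> ends G e" "rep u = rep x" "y \<in> ends G e" "rep v = rep y"
      by blast
    then have "x \<in> verts G" "y \<in> verts G" using mg_graphD(5)[OF G e] by auto
    then have "x \<in> A" "y \<notin> A"
      using sat[of u x] sat[of y v] uv xy \<open>u \<in> A\<close> \<open>v \<notin> A\<close> by auto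
    then show "e \<in> cut_edges G A" using e xy by (auto simp: cut_edges_def)
  qed
  have out: "int (card (incident_edges G x \<inter> cut_edges G A)) = rep x x"
    if x: "x \<in> verts G" "rep x = rep u" for x
    using outA[of x] sat[OF uv(1) x(1)] x(2) \<open>u \<in> A\<close> by simp
  have "A \<subseteq> verts G" by (auto simp: A_def)
  then show ?thesis using sat cut cardA out by (rule that)
qed

text \<open>One divisor supporting all vertices would have degree at least |V| > k. This provides a
  second fibre.\<close>

lemma rep_not_constant:
  assumes "k < card (verts G)" "v \<in> verts G"
  shows "\<exists>w\<in>verts G. rep w \<noteq> rep v"
proof (rule ccontr)
  assume "\<not> (\<exists>w\<in>verts G. rep w \<noteq> rep v)"
  then have "1 \<le> rep v w" if "w \<in> verts G" for w using rep(3)[OF that] that by auto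
  then have "(\<Sum>w\<in>verts G. 1) \<le> div_degree G (rep v)"
    unfolding div_degree_def by (rule sum_mono)
  then show False using rep(4)[OF assms(2)] assms(1) by simp
qed

theorem ex_tree_morphism:
  assumes card: "k < card (verts G)"
  shows "\<exists>(T :: (nat, nat) mgraph) \<phi>. is_tree T \<and> is_harmonic G T \<phi> \<and>
    nondegenerate G T \<phi> \<and> morphism_degree G T \<phi> = k"
proof -
  \<comment> \<open>The tree must live on natural numbers, so the finitely many fibres are
    numbered.\<close>
  obtain h :: "('a \<Rightarrow> int) \<Rightarrow> nat" where h: "inj_on h (rep ` verts G)"
    using finite_imp_inj_to_nat_seg[of "rep ` verts G"] mg_graphD(1)[OF G] by blast
  define \<psi> where "\<psi> v = h (rep v)" for v
  have \<psi>: "\<psi> x = \<psi> y \<longleftrightarrow> rep x = rep y" if "x \<in> verts G" "y \<in> verts G" for x y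
    using h that by (auto simp: \<psi>_def inj_on_def)
  let ?Q = "quotient_graph G \<psi>" and ?\<phi> = "quotient_map G \<psi>"
  have cut: "\<exists>A \<subseteq> verts G.
      (\<forall>x\<in>verts G. \<forall>y\<in>verts G. \<psi> x = \<psi> y \<longrightarrow> x \<in> A \<longrightarrow> y \<in> A) \<and>
      cut_edges G A = {e' \<in> edges G. \<psi> ` ends G e' = \<psi> ` ends G e} \<and>
      card (cut_edges G A) = k \<and>
      (\<forall>x\<in>verts G. \<psi> x = \<psi> u \<longrightarrow> int (card (incident_edges G x \<inter> cut_edges G A)) = rep x x)"
    if e: "e \<in> edges G" "card (\<psi> ` ends G e) = 2" and u: "u \<in> ends G e" for e u
  proof -
    obtain v where uv: "ends G e = {u, v}" "u \<noteq> v" "u \<in> verts G" "v \<in> verts G"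
      using edge_ends_atE[OF G e(1) u] .
    then have "\<psi> u \<noteq> \<psi> v" using e(2) by auto
    then have neq: "rep u \<noteq> rep v" by (auto simp: \<psi>_def)
    obtain A where A: "A \<subseteq> verts G"
      "\<And>x y. x \<in> verts G \<Longrightarrow> y \<in> verts G \<Longrightarrow> rep x = rep y \<Longrightarrow> x \<in> A \<Longrightarrow> y \<in> A"
      "\<And>e. e \<in> edges G \<Longrightarrow> e \<in> cut_edges G A \<longleftrightarrow> rep ` ends G e = {rep u, rep v}"
      "card (cut_edges G A) = k"
      "\<And>x. x \<in> verts G \<Longrightarrow> rep x = rep u \<Longrightarrow>
        int (card (incident_edges G x \<inter> cut_edges G A)) = rep x x"
      by (rule edge_cut[OF e(1) uv(1) neq]) (rule that)
    have "e' \<in> cut_edges G A \<longleftrightarrow> \<psi> ` ends G e' = \<psi> ` ends G e" if e': "e' \<in> edges G" for e'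
    proof -
      have "rep ` ends G e' \<subseteq> rep ` verts G" "rep ` ends G e \<subseteq> rep ` verts G"
        using mg_graphD(5)[OF G] e' e(1) by (simp_all add: image_mono)
      then have "h ` (rep ` ends G e') = h ` (rep ` ends G e) \<longleftrightarrow> rep ` ends G e' = rep ` ends G e"
        by (rule inj_on_image_eq_iff[OF h])
      then show ?thesis using A(3)[OF e'] uv(1) by (simp add: \<psi>_def image_image)
    qed
    moreover have "cut_edges G A \<subseteq> edges G" by (auto simp: cut_edges_def)
    ultimately have eq: "cut_edges G A = {e' \<in> edges G. \<psi> ` ends G e' = \<psi> ` ends G e}" by blast
    show ?thesis
    proof (intro exI[of _ A] conjI ballI impI)
      fix x y assume "x \<in> verts G" "y \<in> verts G" "\<psi> x = \<psi> y" "x \<in> A"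
      with A(2)[of x y] \<psi>[of x y] show "y \<in> A" by simp
    next
      fix x assume "x \<in> verts G" "\<psi> x = \<psi> u"
      with A(5)[of x] \<psi>[of x u] uv(3)
      show "int (card (incident_edges G x \<inter> cut_edges G A)) = rep x x" by simp
    qed (fact A(1) eq A(4))+
  qed
  have tree: "is_tree ?Q"
  proof (rule is_tree_quotient[OF G])
    fix e assume e: "e \<in> edges G" "card (\<psi> ` ends G e) = 2"
    then obtain u where "u \<in> ends G e" using edge_endsE[OF G e(1)] by blast
    from cut[OF e this] show "\<exists>A \<subseteq> verts G.
        (\<forall>x\<in>verts G. \<forall>y\<in>verts G. \<psi> x = \<psi> y \<longrightarrow> x \<in> A \<longrightarrow> y \<in> A) \<and>
        cut_edges G A = {e' \<in> edges G. \<psi> ` ends G e' = \<psi> ` ends G e}" by blast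
  qed
  \<comment> \<open>The multiplicity is the number of chips of the fibre at v, whichever edge e' is
    chosen; this is harmonicity.\<close>
  have mult: "int (edge_mult G ?\<phi> v e') = rep v v"
    if v: "v \<in> verts G" and e': "e' \<in> incident_edges ?Q (vmap ?\<phi> v)" for v e'
  proof -
    have "e' \<in> edges ?Q" and ve': "\<psi> v \<in> set_decode e'"
      using e' by (auto simp: incident_edges_def quotient_graph_sel)
    obtain e where e: "e \<in> edges G" "card (\<psi> ` ends G e) = 2" "e' = set_encode (\<psi> ` ends G e)"
        "set_decode e' = \<psi> ` ends G e"
      using quotient_edgeE[OF \<open>e' \<in> edges ?Q\<close>] .
    obtain u where u: "u \<in> ends G e" "\<psi> v = \<psi> u" using ve' e(4) by auto
    obtain A where A: "cut_edges G A = {e' \<in> edges G. \<psi> ` ends G e' = \<psi> ` ends G e}"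
      "int (card (incident_edges G v \<inter> cut_edges G A)) = rep v v"
      using cut[OF e(1,2) u(1)] v u(2) by blast
    have "{e2 \<in> edges G. v \<in> ends G e2 \<and> emap ?\<phi> e2 = Inr e'} =
        incident_edges G v \<inter> cut_edges G A"
      using emap_quotient_eq_Inr_iff[OF G _ e(2)] unfolding A(1) e(3) incident_edges_def
      by blast
    then show ?thesis using A(2) by (simp add: edge_mult_def)
  qed
  have harm: "is_harmonic G ?Q ?\<phi>"
    unfolding is_harmonic_def
  proof (intro conjI ballI)
    show "is_morphism G ?Q ?\<phi>" by (rule is_morphism_quotient[OF G])
    fix v e1 e2
    assume "v \<in> verts G" "e1 \<in> incident_edges ?Q (vmap ?\<phi> v)" "e2 \<in> incident_edges ?Q (vmap ?\<phi> v)"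
    then have "int (edge_mult G ?\<phi> v e1) = int (edge_mult G ?\<phi> v e2)" using mult by simp
    then show "edge_mult G ?\<phi> v e1 = edge_mult G ?\<phi> v e2" by simp
  qed
  \<comment> \<open>\<open>vertex_mult\<close> is 0 by default where the quotient has no edge, so
    nondegeneracy needs one at each vertex. Connectivity and a second fibre provide it.\<close>
  have inc: "incident_edges ?Q (vmap ?\<phi> v) \<noteq> {}" if v: "v \<in> verts G" for v
  proof -
    obtain w where w: "w \<in> verts G" "rep w \<noteq> rep v" using rep_not_constant[OF card v] by blast
    then have "\<psi> w \<noteq> \<psi> v" using \<psi> v by blast
    then have "{\<psi> v} \<noteq> verts ?Q" using w(1) by (auto simp: quotient_graph_sel)
    then have "cut_edges ?Q {\<psi> v} \<noteq> {}"
      using connected_cut[OF mg_graph_quotient[OF G], of "{\<psi> v}" \<psi>] v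
      by (simp add: quotient_graph_sel)
    then show ?thesis by (auto simp: cut_edges_def incident_edges_def quotient_graph_sel)
  qed
  have nondeg: "nondegenerate G ?Q ?\<phi>"
    unfolding nondegenerate_def
  proof
    fix v assume v: "v \<in> verts G"
    obtain e' where e': "e' \<in> incident_edges ?Q (vmap ?\<phi> v)" using inc[OF v] by blast
    show "0 < vertex_mult G ?Q ?\<phi> v"
      using mult[OF v e'] rep(3)[OF v] vertex_mult_eq[OF harm v e'] by simp
  qed
  have "edges ?Q \<noteq> {}"
    using inc mg_graphD(3)[OF G] by (auto simp: incident_edges_def)
  then have "(SOME e'. e' \<in> edges ?Q) \<in> edges ?Q" by (simp add: some_in_eq)
  then obtain e where e: "e \<in> edges G" "card (\<psi> ` ends G e) = 2"
      "(SOME e'. e' \<in> edges ?Q) = set_encode (\<psi> ` ends G e)"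
    by (rule quotient_edgeE) (rule that)
  obtain u where "u \<in> ends G e" using edge_endsE[OF G e(1)] by blast
  from cut[OF e(1,2) this]
  have "card {e' \<in> edges G. \<psi> ` ends G e' = \<psi> ` ends G e} = k" by metis
  moreover have "{e' \<in> edges G. emap ?\<phi> e' = Inr (set_encode (\<psi> ` ends G e))} =
      {e' \<in> edges G. \<psi> ` ends G e' = \<psi> ` ends G e}"
    using emap_quotient_eq_Inr_iff[OF G _ e(2)] by blast
  ultimately have "morphism_degree G ?Q ?\<phi> = k"
    using \<open>edges ?Q \<noteq> {}\<close> by (simp add: morphism_degree_def e(3))
  with tree harm nondeg show ?thesis by blast
qed

end

section \<open>The equivalence\<close>

text \<open>The third assumption excludes \<open>theta\<close> up to isomorphism, which satisfies
  (2) but not (1).\<close>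

theorem theorem3p1:
  fixes G :: "('v, 'e) mgraph"
  assumes "mg_graph G"
    and "k_edge_connected 3 G"
    and "\<not> (card (verts G) = 2 \<and> card (edges G) = 3)"
  shows "gonality G = 3 \<longleftrightarrow>
    (\<exists>(T :: (nat, nat) mgraph) \<phi>. is_tree T \<and> is_harmonic G T \<phi> \<and>
       nondegenerate G T \<phi> \<and> morphism_degree G T \<phi> = 3)
    \<or> card (verts G) = 3"
proof -
  note G = assms(1)
  have bounded: "cut_bounded G 3" if "3 \<le> card (verts G)"
    using G cut_card_ge[OF G assms(2) that] by unfold_locales
  show ?thesis
  proof
    assume gon: "gonality G = 3"
    then have "3 \<le> card (verts G)" using gonality_le_card[OF G] by simp
    then interpret cut_bounded G 3 by (rule bounded)
    obtain D where "effective G D" "div_degree G D = int 3" "rank_pos G D"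
      using gonality_attained[OF G] gon by metis
    then interpret pencil G 3 D by unfold_locales
    from ex_tree_morphism \<open>3 \<le> card (verts G)\<close>
    show "(\<exists>(T :: (nat, nat) mgraph) \<phi>. is_tree T \<and> is_harmonic G T \<phi> \<and>
       nondegenerate G T \<phi> \<and> morphism_degree G T \<phi> = 3) \<or> card (verts G) = 3"
      by fastforce
  next
    assume R: "(\<exists>(T :: (nat, nat) mgraph) \<phi>. is_tree T \<and> is_harmonic G T \<phi> \<and>
       nondegenerate G T \<phi> \<and> morphism_degree G T \<phi> = 3) \<or> card (verts G) = 3"
    \<comment> \<open>Three vertices must be secured first, since the cut bound depends on them. A
      single vertex has no edges and gives degree 0; two vertices would give the excluded
      graph.\<close>
    have bounds: "3 \<le> card (verts G) \<and> gonality G \<le> 3"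
      using R
    proof
      assume "\<exists>(T :: (nat, nat) mgraph) \<phi>. is_tree T \<and> is_harmonic G T \<phi> \<and>
        nondegenerate G T \<phi> \<and> morphism_degree G T \<phi> = 3"
      then obtain T :: "(nat, nat) mgraph" and \<phi> where T: "is_tree T" "is_harmonic G T \<phi>"
        "nondegenerate G T \<phi>" "morphism_degree G T \<phi> = 3" by blast
      have mor: "is_morphism G T \<phi>" using T(2) by (simp add: is_harmonic_def)
      have edge: "edges T \<noteq> {}" using T(4) by (auto simp: morphism_degree_def)
      have "card (verts G) \<noteq> 0" using mg_graphD(1,3)[OF G] by simp
      moreover have "card (verts G) \<noteq> 2"
        using morphism_degree_two_vertices[OF G T(1) mor] T(4) assms(3) by auto
      moreover have "card (verts G) \<noteq> 1"
      proof
        assume one: "card (verts G) = 1"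
        have "edges G = {}"
        proof (rule ccontr)
          assume "edges G \<noteq> {}"
          then obtain e where "e \<in> edges G" by blast
          then have "2 \<le> card (verts G)"
            using card_mono[OF mg_graphD(1)[OF G] mg_graphD(5)[OF G]] mg_graphD(6)[OF G] by metis
          with one show False by simp
        qed
        then have "morphism_degree G T \<phi> = 0" by (simp add: morphism_degree_def)
        with T(4) show False by simp
      qed
      ultimately show ?thesis
        using gonality_le_morphism_degree[OF G T(1-3) edge] T(4) by linarith
    next
      assume "card (verts G) = 3"
      then show ?thesis using gonality_le_card[OF G] by simp
    qed
    then interpret cut_bounded G 3 by (intro bounded) simp
    show "gonality G = 3" using gonality_ge bounds by simp
  qed
qed

end
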